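(* Let $A*B$ be the free product of torsion free groups $A$ and $B$. (1) No nontrivial element $a\in A$ is a product of elements of $A*B$ that are conjugate to each other in $A*B$ and are not conjugate in $A*B$ to an element of $A$. (2) More generally, suppose that $$a_1b_1\cdots a_\ell b_\ell=h_1\cdots h_m\ne 1$$ in $A*B$, where $a_1,\dots,a_\ell\in A\setminus\{1\}$, $b_1,\dots,b_\ell\in B\setminus\{1\}$, and $h_1,\dots,h_m\in A*B$ are conjugate to each other in $A*B$ and are not conjugate in $A*B$ to an element of $A\cup B$. Then no element occurs in the sequence $h_1,\dots,h_m$ more than $2\ell-1$ times.
   Context: The groups $A$ and $B$ are identified with their canonical images (free factors) in $A*B$. *)

theory Defs
  imports "HOL-Algebra.Group"
begin

definition torsion_free_group :: "('a, 'm) monoid_scheme \<Rightarrow> bool" where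
  "torsion_free_group G \<longleftrightarrow>
     group G \<and>
     (\<forall>x \<in> carrier G. \<forall>n::nat. 0 < n \<and> x [^]\<^bsub>G\<^esub> n = \<one>\<^bsub>G\<^esub> \<longrightarrow> x = \<one>\<^bsub>G\<^esub>)"

definition conjugate_in :: "('a, 'm) monoid_scheme \<Rightarrow> 'a \<Rightarrow> 'a \<Rightarrow> bool" where
  "conjugate_in G x y \<longleftrightarrow> (\<exists>g \<in> carrier G. y = g \<otimes>\<^bsub>G\<^esub> x \<otimes>\<^bsub>G\<^esub> inv\<^bsub>G\<^esub> g)"

definition list_prod :: "('a, 'm) monoid_scheme \<Rightarrow> 'a list \<Rightarrow> 'a" where
  "list_prod G xs = foldr (\<otimes>\<^bsub>G\<^esub>) xs \<one>\<^bsub>G\<^esub>"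

text \<open>
  The free product is realised on reduced words: lists of nontrivial elements taken
  alternately from the two factors. Two words are multiplied by prepending
  the letters of the first (last letter first) to the second, reducing at each step.
  That this gives the free product in the usual sense (a group, with injective homomorphisms from
  \<open>A\<close> and \<open>B\<close>, and universal) is proved in the theorems
  \<open>group_free_product\<close>, \<open>free_product_inl_mon\<close>, \<open>free_product_inr_mon\<close> and
  \<open>free_product_universal\<close>.
\<close>

definition reduced_words ::
    "('a, 'm) monoid_scheme \<Rightarrow> ('b, 'n) monoid_scheme \<Rightarrow> ('a + 'b) list set" where
  "reduced_words A B =
     {w. set w \<subseteq> (carrier A - {\<one>\<^bsub>A\<^esub>}) <+> (carrier B - {\<one>\<^bsub>B\<^esub>}) \<and>
         successively (\<lambda>x y. isl x \<noteq> isl y) w}"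

fun prepend_letter ::
    "('a, 'm) monoid_scheme \<Rightarrow> ('b, 'n) monoid_scheme \<Rightarrow> 'a + 'b \<Rightarrow> ('a + 'b) list \<Rightarrow> ('a + 'b) list"
where
  "prepend_letter A B (Inl x) w =
     (if x = \<one>\<^bsub>A\<^esub> then w
      else case w of
        Inl y # v \<Rightarrow> if x \<otimes>\<^bsub>A\<^esub> y = \<one>\<^bsub>A\<^esub> then v else Inl (x \<otimes>\<^bsub>A\<^esub> y) # v
      | _ \<Rightarrow> Inl x # w)"
| "prepend_letter A B (Inr x) w =
     (if x = \<one>\<^bsub>B\<^esub> then w
      else case w of
        Inr y # v \<Rightarrow> if x \<otimes>\<^bsub>B\<^esub> y = \<one>\<^bsub>B\<^esub> then v else Inr (x \<otimes>\<^bsub>B\<^esub> y) # v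
      | _ \<Rightarrow> Inr x # w)"

definition free_product ::
    "('a, 'm) monoid_scheme \<Rightarrow> ('b, 'n) monoid_scheme \<Rightarrow> ('a + 'b) list monoid" where
  "free_product A B =
     \<lparr>carrier = reduced_words A B, monoid.mult = foldr (prepend_letter A B), one = []\<rparr>"

definition free_product_inl :: "('a, 'm) monoid_scheme \<Rightarrow> 'a \<Rightarrow> ('a + 'b) list" where
  "free_product_inl A a = (if a = \<one>\<^bsub>A\<^esub> then [] else [Inl a])"

definition free_product_inr :: "('b, 'n) monoid_scheme \<Rightarrow> 'b \<Rightarrow> ('a + 'b) list" where
  "free_product_inr B b = (if b = \<one>\<^bsub>B\<^esub> then [] else [Inr b])"


lemma reduced_words_Nil [simp]: "[] \<in> reduced_words A B"
  by (simp add: reduced_words_def)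

lemma reduced_words_Cons:
  "l # w \<in> reduced_words A B \<longleftrightarrow>
     l \<in> (carrier A - {\<one>\<^bsub>A\<^esub>}) <+> (carrier B - {\<one>\<^bsub>B\<^esub>}) \<and> w \<in> reduced_words A B \<and>
     (w = [] \<or> isl l \<noteq> isl (hd w))"
  by (auto simp: reduced_words_def successively_Cons)

context
  fixes A :: "('a, 'm) monoid_scheme" and B :: "('b, 'n) monoid_scheme"
  assumes A: "group A" and B: "group B"
begin

interpretation A: group A by (rule A)
interpretation B: group B by (rule B)

lemma prepend_letter_closed:
  assumes "l \<in> carrier A <+> carrier B" "w \<in> reduced_words A B"
  shows "prepend_letter A B l w \<in> reduced_words A B"
  using assms
  by (cases l; cases w)
     (auto simp: reduced_words_Cons split: sum.splits list.splits)

lemma prepend_letter_reduced: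
  assumes "l # w \<in> reduced_words A B"
  shows "prepend_letter A B l w = l # w"
  using assms
  by (cases l; cases w)
     (auto simp: reduced_words_Cons split: sum.splits list.splits)

lemma prepend_letter_Inl_mult:
  assumes "x \<in> carrier A" "y \<in> carrier A" "w \<in> reduced_words A B"
  shows "prepend_letter A B (Inl x) (prepend_letter A B (Inl y) w) =
         prepend_letter A B (Inl (x \<otimes>\<^bsub>A\<^esub> y)) w"
proof (cases "\<exists>z v. w = Inl z # v")
  case True
  then obtain z v where w: "w = Inl z # v" by blast
  with assms have z: "z \<in> carrier A" "z \<noteq> \<one>\<^bsub>A\<^esub>" and v: "v = [] \<or> \<not> isl (hd v)"
    by (auto simp: reduced_words_Cons)
  have v': "(case v of Inl y' # v' \<Rightarrow> P y' v' | _ \<Rightarrow> Q) = Q" for P and Q :: "('a + 'b) list"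
    using v by (cases v) (auto split: sum.splits)
  have a: "x \<otimes>\<^bsub>A\<^esub> (y \<otimes>\<^bsub>A\<^esub> z) = x \<otimes>\<^bsub>A\<^esub> y \<otimes>\<^bsub>A\<^esub> z"
    using assms z by (simp add: A.m_assoc)
  show ?thesis
  proof (cases "y \<otimes>\<^bsub>A\<^esub> z = \<one>\<^bsub>A\<^esub>")
    case yz: True
    then have "x = x \<otimes>\<^bsub>A\<^esub> y \<otimes>\<^bsub>A\<^esub> z" using a assms by simp
    moreover have "x \<otimes>\<^bsub>A\<^esub> y = \<one>\<^bsub>A\<^esub> \<longleftrightarrow> x = z"
      using yz assms z by (metis A.inv_equality A.inv_inv A.l_inv A.inv_closed)
    ultimately show ?thesis
      using assms z w yz v' by (auto split: if_splits)
  next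
    case False
    moreover have "x \<otimes>\<^bsub>A\<^esub> y = \<one>\<^bsub>A\<^esub> \<Longrightarrow> x \<otimes>\<^bsub>A\<^esub> (y \<otimes>\<^bsub>A\<^esub> z) = z"
      using a z by simp
    ultimately show ?thesis
      using assms z w a by (auto split: if_splits)
  qed
next
  case False
  then show ?thesis
    using assms by (auto split: list.splits sum.splits)
qed

lemma prepend_letter_Inr_mult:
  assumes "x \<in> carrier B" "y \<in> carrier B" "w \<in> reduced_words A B"
  shows "prepend_letter A B (Inr x) (prepend_letter A B (Inr y) w) =
         prepend_letter A B (Inr (x \<otimes>\<^bsub>B\<^esub> y)) w"
proof (cases "\<exists>z v. w = Inr z # v")
  case True
  then obtain z v where w: "w = Inr z # v" by blast
  with assms have z: "z \<in> carrier B" "z \<noteq> \<one>\<^bsub>B\<^esub>" and v: "v = [] \<or> isl (hd v)"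
    by (auto simp: reduced_words_Cons)
  have v': "(case v of Inr y' # v' \<Rightarrow> P y' v' | _ \<Rightarrow> Q) = Q" for P and Q :: "('a + 'b) list"
    using v by (cases v) (auto split: sum.splits)
  have a: "x \<otimes>\<^bsub>B\<^esub> (y \<otimes>\<^bsub>B\<^esub> z) = x \<otimes>\<^bsub>B\<^esub> y \<otimes>\<^bsub>B\<^esub> z"
    using assms z by (simp add: B.m_assoc)
  show ?thesis
  proof (cases "y \<otimes>\<^bsub>B\<^esub> z = \<one>\<^bsub>B\<^esub>")
    case yz: True
    then have "x = x \<otimes>\<^bsub>B\<^esub> y \<otimes>\<^bsub>B\<^esub> z" using a assms by simp
    moreover have "x \<otimes>\<^bsub>B\<^esub> y = \<one>\<^bsub>B\<^esub> \<longleftrightarrow> x = z"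
      using yz assms z by (metis B.inv_equality B.inv_inv B.l_inv B.inv_closed)
    ultimately show ?thesis
      using assms z w yz v' by (auto split: if_splits)
  next
    case False
    moreover have "x \<otimes>\<^bsub>B\<^esub> y = \<one>\<^bsub>B\<^esub> \<Longrightarrow> x \<otimes>\<^bsub>B\<^esub> (y \<otimes>\<^bsub>B\<^esub> z) = z"
      using a z by simp
    ultimately show ?thesis
      using assms z w a by (auto split: if_splits)
  qed
next
  case False
  then show ?thesis
    using assms by (auto split: list.splits sum.splits)
qed

lemma foldr_prepend_letter_closed:
  assumes "u \<in> reduced_words A B" "w \<in> reduced_words A B"
  shows "foldr (prepend_letter A B) u w \<in> reduced_words A B"
  using assms
proof (induction u)
  case (Cons l u)
  then have "l \<in> carrier A <+> carrier B" "u \<in> reduced_words A B"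
    by (auto simp: reduced_words_Cons)
  with Cons show ?case by (simp add: prepend_letter_closed)
qed simp

lemma foldr_prepend_letter_prepend_letter:
  assumes "l \<in> carrier A <+> carrier B" "v \<in> reduced_words A B" "w \<in> reduced_words A B"
  shows "foldr (prepend_letter A B) (prepend_letter A B l v) w =
         prepend_letter A B l (foldr (prepend_letter A B) v w)"
proof (cases v)
  case Nil
  then show ?thesis by (cases l) auto
next
  case (Cons k v')
  let ?p = "foldr (prepend_letter A B) v' w"
  have p: "?p \<in> reduced_words A B"
    using assms Cons by (simp add: reduced_words_Cons foldr_prepend_letter_closed)
  have one: "prepend_letter A B (Inl \<one>\<^bsub>A\<^esub>) ?p = ?p" "prepend_letter A B (Inr \<one>\<^bsub>B\<^esub>) ?p = ?p"
    by simp_all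
  show ?thesis
  proof (cases l)
    case l: (Inl x)
    show ?thesis
    proof (cases k)
      case k: (Inl y)
      have "x \<in> carrier A" "y \<in> carrier A"
        using assms Cons l k by (auto simp: reduced_words_Cons)
      note xy = prepend_letter_Inl_mult[OF this p]
      show ?thesis
      proof (cases "x = \<one>\<^bsub>A\<^esub>")
        case True
        then show ?thesis using l by simp
      next
        case False
        then have "prepend_letter A B (Inl x) (Inl y # v') =
            (if x \<otimes>\<^bsub>A\<^esub> y = \<one>\<^bsub>A\<^esub> then v' else Inl (x \<otimes>\<^bsub>A\<^esub> y) # v')"
          by simp
        with xy show ?thesis
          using Cons l k one by (simp del: prepend_letter.simps)
      qed
    next
      case (Inr y)
      then show ?thesis using Cons l by simp
    qed
  next
    case l: (Inr x)
    show ?thesis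
    proof (cases k)
      case k: (Inr y)
      have "x \<in> carrier B" "y \<in> carrier B"
        using assms Cons l k by (auto simp: reduced_words_Cons)
      note xy = prepend_letter_Inr_mult[OF this p]
      show ?thesis
      proof (cases "x = \<one>\<^bsub>B\<^esub>")
        case True
        then show ?thesis using l by simp
      next
        case False
        then have "prepend_letter A B (Inr x) (Inr y # v') =
            (if x \<otimes>\<^bsub>B\<^esub> y = \<one>\<^bsub>B\<^esub> then v' else Inr (x \<otimes>\<^bsub>B\<^esub> y) # v')"
          by simp
        with xy show ?thesis
          using Cons l k one by (simp del: prepend_letter.simps)
      qed
    next
      case (Inl y)
      then show ?thesis using Cons l by simp
    qed
  qed
qed

lemma free_product_assoc:
  assumes "u \<in> reduced_words A B" "v \<in> reduced_words A B" "w \<in> reduced_words A B"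
  shows "foldr (prepend_letter A B) (foldr (prepend_letter A B) u v) w =
         foldr (prepend_letter A B) u (foldr (prepend_letter A B) v w)"
  using assms
proof (induction u)
  case (Cons l u)
  then have "l \<in> carrier A <+> carrier B" "u \<in> reduced_words A B"
    by (auto simp: reduced_words_Cons)
  with Cons show ?case
    by (simp add: foldr_prepend_letter_prepend_letter foldr_prepend_letter_closed)
qed simp

lemma free_product_left_inverse:
  assumes "u \<in> reduced_words A B"
  shows "\<exists>v \<in> reduced_words A B. foldr (prepend_letter A B) v u = []"
  using assms
proof (induction u)
  case (Cons l u)
  then have l: "l \<in> (carrier A - {\<one>\<^bsub>A\<^esub>}) <+> (carrier B - {\<one>\<^bsub>B\<^esub>})" and u: "u \<in> reduced_words A B"
    by (auto simp: reduced_words_Cons)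
  then obtain v where v: "v \<in> reduced_words A B" "foldr (prepend_letter A B) v u = []"
    using Cons.IH by blast
  define k where "k = (case l of Inl x \<Rightarrow> Inl (inv\<^bsub>A\<^esub> x) | Inr x \<Rightarrow> Inr (inv\<^bsub>B\<^esub> x))"
  have k: "[k] \<in> reduced_words A B" "prepend_letter A B k (l # u) = u"
    using l by (auto simp: k_def reduced_words_Cons split: if_splits)
  have "foldr (prepend_letter A B) (foldr (prepend_letter A B) v [k]) (l # u) = []"
    using free_product_assoc[OF v(1) k(1) Cons.prems] k(2) v(2) by simp
  then show ?case
    using foldr_prepend_letter_closed[OF v(1) k(1)] by blast
qed (auto intro: bexI[of _ "[]"])

theorem group_free_product: "group (free_product A B)"
proof (rule groupI)
  fix u assume "u \<in> carrier (free_product A B)"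
  then show "\<exists>v\<in>carrier (free_product A B). v \<otimes>\<^bsub>free_product A B\<^esub> u = \<one>\<^bsub>free_product A B\<^esub>"
    using free_product_left_inverse by (simp add: free_product_def)
qed (simp_all add: free_product_def foldr_prepend_letter_closed free_product_assoc)

theorem free_product_inl_mon: "free_product_inl A \<in> mon A (free_product A B)"
  by (auto simp: mon_def hom_def inj_on_def free_product_inl_def free_product_def reduced_words_Cons)

theorem free_product_inr_mon: "free_product_inr B \<in> mon B (free_product A B)"
  by (auto simp: mon_def hom_def inj_on_def free_product_inr_def free_product_def reduced_words_Cons)

theorem free_product_universal:
  assumes H: "group H" and f: "f \<in> hom A H" and g: "g \<in> hom B H"
  shows "\<exists>h \<in> hom (free_product A B) H.
           (\<forall>a \<in> carrier A. h (free_product_inl A a) = f a) \<and>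
           (\<forall>b \<in> carrier B. h (free_product_inr B b) = g b)"
    and "\<lbrakk>h \<in> hom (free_product A B) H; k \<in> hom (free_product A B) H;
          \<And>a. a \<in> carrier A \<Longrightarrow> h (free_product_inl A a) = k (free_product_inl A a);
          \<And>b. b \<in> carrier B \<Longrightarrow> h (free_product_inr B b) = k (free_product_inr B b);
          w \<in> carrier (free_product A B)\<rbrakk> \<Longrightarrow> h w = k w"
proof -
  interpret H: group H by (rule H)
  interpret f: group_hom A H f using f by unfold_locales
  interpret g: group_hom B H g using g by unfold_locales
  define c where "c l = (case l of Inl x \<Rightarrow> f x | Inr y \<Rightarrow> g y)" for l
  define h where "h w = foldr (\<lambda>l z. c l \<otimes>\<^bsub>H\<^esub> z) w \<one>\<^bsub>H\<^esub>" for w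
  have c: "c l \<in> carrier H" if "l \<in> carrier A <+> carrier B" for l
    using that by (auto simp: c_def)
  have h_closed: "h w \<in> carrier H" if "w \<in> reduced_words A B" for w
    using that
  proof (induction w)
    case (Cons l w)
    then have "l \<in> carrier A <+> carrier B" "w \<in> reduced_words A B"
      by (auto simp: reduced_words_Cons)
    with Cons show ?case by (simp add: h_def c)
  qed (simp add: h_def)
  have h_prepend: "h (prepend_letter A B l w) = c l \<otimes>\<^bsub>H\<^esub> h w"
    if "l \<in> carrier A <+> carrier B" "w \<in> reduced_words A B" for l w
  proof (cases w)
    case Nil
    then show ?thesis using that by (cases l) (auto simp: h_def c_def)
  next
    case (Cons k v)
    then have k: "k \<in> carrier A <+> carrier B" and v: "v \<in> reduced_words A B"
      using that by (auto simp: reduced_words_Cons)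
    have hv: "h v \<in> carrier H" and h_Cons: "h (l' # w') = c l' \<otimes>\<^bsub>H\<^esub> h w'" for l' w'
      using h_closed[OF v] by (simp_all add: h_def)
    show ?thesis
    proof (cases l)
      case l: (Inl x)
      show ?thesis
      proof (cases k)
        case k': (Inl y)
        have xy: "x \<in> carrier A" "y \<in> carrier A" using that k l k' by auto
        then have "f x \<otimes>\<^bsub>H\<^esub> (f y \<otimes>\<^bsub>H\<^esub> h v) = f (x \<otimes>\<^bsub>A\<^esub> y) \<otimes>\<^bsub>H\<^esub> h v"
          using hv by (simp add: H.m_assoc)
        then show ?thesis
          using l k' Cons hv xy
          by (cases "x = \<one>\<^bsub>A\<^esub>"; cases "x \<otimes>\<^bsub>A\<^esub> y = \<one>\<^bsub>A\<^esub>") (simp_all add: h_Cons c_def)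
      next
        case (Inr y)
        then show ?thesis using l Cons k hv by (auto simp: h_Cons c_def)
      qed
    next
      case l: (Inr x)
      show ?thesis
      proof (cases k)
        case k': (Inr y)
        have xy: "x \<in> carrier B" "y \<in> carrier B" using that k l k' by auto
        then have "g x \<otimes>\<^bsub>H\<^esub> (g y \<otimes>\<^bsub>H\<^esub> h v) = g (x \<otimes>\<^bsub>B\<^esub> y) \<otimes>\<^bsub>H\<^esub> h v"
          using hv by (simp add: H.m_assoc)
        then show ?thesis
          using l k' Cons hv xy
          by (cases "x = \<one>\<^bsub>B\<^esub>"; cases "x \<otimes>\<^bsub>B\<^esub> y = \<one>\<^bsub>B\<^esub>") (simp_all add: h_Cons c_def)
      next
        case (Inl y)
        then show ?thesis using l Cons k hv by (auto simp: h_Cons c_def)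
      qed
    qed
  qed
  have "h (foldr (prepend_letter A B) u w) = h u \<otimes>\<^bsub>H\<^esub> h w"
    if "u \<in> reduced_words A B" "w \<in> reduced_words A B" for u w
    using that
  proof (induction u)
    case Nil
    then show ?case using h_closed by (simp add: h_def)
  next
    case (Cons l u)
    then have l: "l \<in> carrier A <+> carrier B" and u: "u \<in> reduced_words A B"
      by (auto simp: reduced_words_Cons)
    then show ?case
      using Cons h_prepend[OF l foldr_prepend_letter_closed[OF u Cons.prems(2)]]
        H.m_assoc[OF c[OF l] h_closed[OF u] h_closed[OF Cons.prems(2)]]
      by (simp add: h_def)
  qed
  then have "h \<in> hom (free_product A B) H"
    using h_closed by (auto simp: hom_def free_product_def)
  moreover have "\<forall>a \<in> carrier A. h (free_product_inl A a) = f a"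
    and "\<forall>b \<in> carrier B. h (free_product_inr B b) = g b"
    by (auto simp: h_def c_def free_product_inl_def free_product_inr_def)
  ultimately show "\<exists>h \<in> hom (free_product A B) H.
           (\<forall>a \<in> carrier A. h (free_product_inl A a) = f a) \<and>
           (\<forall>b \<in> carrier B. h (free_product_inr B b) = g b)"
    by blast
next
  assume hom: "h \<in> hom (free_product A B) H" "k \<in> hom (free_product A B) H"
    and l: "\<And>a. a \<in> carrier A \<Longrightarrow> h (free_product_inl A a) = k (free_product_inl A a)"
    and r: "\<And>b. b \<in> carrier B \<Longrightarrow> h (free_product_inr B b) = k (free_product_inr B b)"
    and "w \<in> carrier (free_product A B)"
  then have "w \<in> reduced_words A B" by (simp add: free_product_def)
  then show "h w = k w"
  proof (induction w)
    case Nil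
    then show ?case
      using l[of "\<one>\<^bsub>A\<^esub>"] by (simp add: free_product_inl_def)
  next
    case (Cons x w)
    then have w: "w \<in> reduced_words A B" and x: "[x] \<in> reduced_words A B"
      by (auto simp: reduced_words_Cons)
    have eq: "x # w = [x] \<otimes>\<^bsub>free_product A B\<^esub> w"
      using prepend_letter_reduced[OF Cons.prems] by (simp add: free_product_def)
    have "h [x] = k [x]"
    proof (cases x)
      case (Inl a)
      with x l[of a] show ?thesis by (auto simp: reduced_words_Cons free_product_inl_def split: if_splits)
    next
      case (Inr b)
      with x r[of b] show ?thesis by (auto simp: reduced_words_Cons free_product_inr_def split: if_splits)
    qed
    then show ?case
      using hom_mult[OF hom(1), of "[x]" w] hom_mult[OF hom(2), of "[x]" w] w x Cons.IH[OF w]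
      unfolding eq by (simp add: free_product_def)
  qed
qed

end

end

theory Submission
  imports Defs
begin

text \<open>
  View a product of conjugates of a cyclically reduced word \<open>h = c\<^sub>0 \<dots> c\<^bsub>n-1\<^esub>\<close> as a
  planar diagram: faces are copies of \<open>h\<close>, vertices carry a relation in one factor between the
  letters of the corners around them. Read the indices of the corners around a vertex cyclically. If they are not all equal,
  there is an ascent; all equal indices would make a letter of \<open>h\<close> a torsion element. An edge
  between two faces has exactly one ascent among its two ends, unless it wraps around, that is, it is the last edge of one of
  the faces. Counting ascents against vertices, edges and faces contradicts Euler's formula
  when all vertices but one are of this kind, and in general bounds from below the length of the boundary.

  The diagram is never constructed. Only its outer boundary word is kept, together with the
  corner indices along the boundary of each region, and one shows that the inequality \<open>ascents < wraps\<close> survives each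
  cancellation in the boundary word. For part 2, the \<open>k\<close> equal factors are first collected into one face \<open>h\<^sup>k\<close>,
  whose boundary has \<open>k\<close> wraps; the surplus \<open>k - 1\<close> is never lost.
\<close>

section \<open>Positions of adjacent letters relative to a cut of a list\<close>

lemma pair_split:
  assumes "us @ w # z # vs = p @ q"
  obtains (L) r where "p = us @ w # z # r" "vs = r @ q"
  | (M) "p = us @ [w]" "q = z # vs"
  | (R) r where "us = p @ r" "q = r @ w # z # vs"
  using assms by (auto simp: append_eq_append_conv2 Cons_eq_append_conv append_eq_Cons_conv)

lemma triple_split:
  assumes "us @ w # v # z # vs = p @ q"
  obtains (L) r where "p = us @ w # v # z # r" "vs = r @ q"
  | (M1) "p = us @ [w, v]" "q = z # vs"
  | (M2) "p = us @ [w]" "q = v # z # vs"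
  | (R) r where "us = p @ r" "q = r @ w # v # z # vs"
  using assms by (auto simp: append_eq_append_conv2 Cons_eq_append_conv append_eq_Cons_conv)

text \<open>Interior letters have a neighbour on either side, so these are the ones at which two
  edges of a boundary word can be folded together.\<close>

lemma mem_interiorD:
  assumes "x \<in> set (butlast (tl ws))"
  obtains us w z vs where "ws = us @ w # x # z # vs"
proof -
  obtain w ws' where ws: "ws = w # ws'" using assms by (cases ws) auto
  with assms obtain p q where "butlast ws' = p @ x # q" by (auto simp: in_set_conv_decomp)
  moreover have "ws' = butlast ws' @ [last ws']" using assms ws by (cases ws') auto
  ultimately have ws': "ws' = p @ x # q @ [last ws']" by simp
  obtain us w' where "w # p = us @ [w']" by (cases p rule: rev_cases) auto
  moreover obtain z vs where "q @ [last ws'] = z # vs" by (cases q) auto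
  moreover have "ws = (w # p) @ x # (q @ [last ws'])" using ws ws' by simp
  ultimately have "ws = us @ w' # x # z # vs" by simp
  then show ?thesis by (rule that)
qed

section \<open>Words alternating between two subgroups\<close>

locale two_subgroups = group G for G (structure) +
  fixes H :: "bool \<Rightarrow> 'a set"
  assumes H_subgroup: "subgroup (H t) G"
begin

lemma H_carrier: "x \<in> H t \<Longrightarrow> x \<in> carrier G"
  using H_subgroup subgroup.mem_carrier by fastforce

lemma H_closed [simp]:
  "x \<in> H t \<Longrightarrow> y \<in> H t \<Longrightarrow> x \<otimes> y \<in> H t" "x \<in> H t \<Longrightarrow> inv x \<in> H t" "\<one> \<in> H t"
  using H_subgroup subgroup.m_closed subgroup.m_inv_closed subgroup.one_closed by metis+

lemma H_assoc: "x \<in> H t \<Longrightarrow> y \<in> H t \<Longrightarrow> z \<in> H t \<Longrightarrow> x \<otimes> y \<otimes> z = x \<otimes> (y \<otimes> z)"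
  using H_carrier m_assoc by simp

text \<open>A corner split into the pieces \<open>x\<close> and \<open>y\<close> may be split at
  another place; this is needed when the attaching corner of a block changes.\<close>

lemma mult_inv_mult:
  "x \<in> H t \<Longrightarrow> s \<in> H t \<Longrightarrow> y \<in> H t \<Longrightarrow> (x \<otimes> inv s) \<otimes> (s \<otimes> y) = x \<otimes> y"
  by (simp add: H_assoc[of _ t] H_carrier[of _ t] flip: m_assoc[of "inv s" s y])

fun alternating :: "bool \<Rightarrow> 'a list \<Rightarrow> bool" where
  "alternating t [] = True"
| "alternating t (x # xs) = (x \<in> H t \<and> alternating (\<not> t) xs)"

lemma alternating_append [simp]:
  "alternating t (xs @ ys) \<longleftrightarrow> alternating t xs \<and> alternating (t = even (length xs)) ys"
proof (induction xs arbitrary: t)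
  case (Cons x xs)
  have "((\<not> t) = even (length xs)) = (t = even (length (x # xs)))" by auto
  then show ?case using Cons by simp
qed simp

lemma alternating_carrier: "alternating t xs \<Longrightarrow> set xs \<subseteq> carrier G"
  by (induction xs arbitrary: t) (auto simp: H_carrier)

end

section \<open>Products, powers and conjugates in a group\<close>

context group
begin

lemma list_prod_Nil [simp]: "list_prod G [] = \<one>"
  and list_prod_Cons [simp]: "list_prod G (x # xs) = x \<otimes> list_prod G xs"
  by (simp_all add: list_prod_def)

lemma list_prod_closed [simp]: "set xs \<subseteq> carrier G \<Longrightarrow> list_prod G xs \<in> carrier G"
  by (induction xs) simp_all

lemma list_prod_append [simp]:
  "set xs \<subseteq> carrier G \<Longrightarrow> set ys \<subseteq> carrier G \<Longrightarrow> list_prod G (xs @ ys) = list_prod G xs \<otimes> list_prod G ys"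
  by (induction xs) (simp_all add: m_assoc)

lemma mult_inv_cancel:
  assumes "x \<in> carrier G" "y \<in> carrier G"
  shows "x \<otimes> (inv x \<otimes> y) = y" "inv x \<otimes> (x \<otimes> y) = y"
  using assms by (simp_all flip: m_assoc)

text \<open>The power of \<open>x\<close> is collected at the front. A factor \<open>h\<close>
  different from \<open>x\<close> that stands before a power \<open>p\<close> moves behind it as
  \<open>inv p \<otimes> h \<otimes> p\<close>, so it stays in its conjugacy class.\<close>

lemma list_prod_count:
  assumes "set hs \<subseteq> carrier G"
  shows "\<exists>ys. list_prod G hs = x [^] count_list hs x \<otimes> list_prod G ys \<and>
    (\<forall>y \<in> set ys. \<exists>h \<in> set hs. \<exists>g \<in> carrier G. y = g \<otimes> h \<otimes> inv g)"
  using assms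
proof (induction hs)
  case Nil
  then show ?case by (intro exI[of _ "[]"]) simp
next
  case (Cons h hs)
  then have h: "h \<in> carrier G" "set hs \<subseteq> carrier G" by simp_all
  obtain ys where eq: "list_prod G hs = x [^] count_list hs x \<otimes> list_prod G ys"
    and ys: "\<And>y. y \<in> set ys \<Longrightarrow> \<exists>k \<in> set hs. \<exists>g \<in> carrier G. y = g \<otimes> k \<otimes> inv g"
    using Cons.IH[OF h(2)] by blast
  have "y \<in> carrier G" if "y \<in> set ys" for y
    using ys[OF that] h(2) by auto
  then have car: "set ys \<subseteq> carrier G" by blast
  show ?case
  proof (cases "h = x")
    case True
    then have "list_prod G (h # hs) = x [^] count_list (h # hs) x \<otimes> list_prod G ys"
      using eq h car nat_pow_Suc2[of x "count_list hs x"] by (simp add: m_assoc)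
    with ys show ?thesis by (intro exI[of _ ys]) simp
  next
    case False
    define p where "p = x [^] count_list hs x"
    \<comment> \<open>If \<open>x\<close> does not occur in \<open>hs\<close>, it may lie outside
      the group, but then the exponent is 0.\<close>
    have p: "p \<in> carrier G"
    proof (cases "x \<in> set hs")
      case True
      then show ?thesis using h(2) by (auto simp: p_def)
    qed (simp add: p_def)
    define y where "y = inv p \<otimes> h \<otimes> inv (inv p)"
    have "p \<otimes> (y \<otimes> list_prod G ys) = h \<otimes> (p \<otimes> list_prod G ys)"
      using p h car by (simp add: y_def m_assoc mult_inv_cancel)
    then have "list_prod G (h # hs) = x [^] count_list (h # hs) x \<otimes> list_prod G (y # ys)"
      using eq False by (simp add: p_def)
    moreover have "\<exists>k \<in> set (h # hs). \<exists>g \<in> carrier G. y = g \<otimes> k \<otimes> inv g"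
      using p by (intro bexI[of _ h] bexI[of _ "inv p"]) (simp_all add: y_def)
    ultimately show ?thesis using ys by (intro exI[of _ "y # ys"]) simp
  qed
qed

lemma conjugate_pow:
  assumes "g \<in> carrier G" "x \<in> carrier G"
  shows "(g \<otimes> x \<otimes> inv g) [^] (k::nat) = g \<otimes> x [^] k \<otimes> inv g"
  using assms by (induction k) (simp_all add: m_assoc mult_inv_cancel)

lemma conjugate_in_refl: "x \<in> carrier G \<Longrightarrow> conjugate_in G x x"
  unfolding conjugate_in_def by (intro bexI[of _ \<one>]) simp_all

lemma conjugate_in_sym:
  assumes "conjugate_in G x y" "x \<in> carrier G"
  shows "conjugate_in G y x"
proof -
  obtain g where g: "g \<in> carrier G" "y = g \<otimes> x \<otimes> inv g" using assms by (auto simp: conjugate_in_def)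
  have "inv g \<otimes> y \<otimes> inv (inv g) = x"
    using g assms(2) by (simp add: m_assoc mult_inv_cancel)
  then show ?thesis using g unfolding conjugate_in_def by (intro bexI[of _ "inv g"]) simp_all
qed

lemma conjugate_in_trans:
  assumes "conjugate_in G x y" "conjugate_in G y z" "x \<in> carrier G"
  shows "conjugate_in G x z"
proof -
  obtain g where g: "g \<in> carrier G" "y = g \<otimes> x \<otimes> inv g" using assms by (auto simp: conjugate_in_def)
  obtain k where k: "k \<in> carrier G" "z = k \<otimes> y \<otimes> inv k" using assms by (auto simp: conjugate_in_def)
  have "z = (k \<otimes> g) \<otimes> x \<otimes> inv (k \<otimes> g)"
    using g k assms(3) by (simp add: m_assoc inv_mult_group)
  then show ?thesis using g k unfolding conjugate_in_def by (intro bexI[of _ "k \<otimes> g"]) simp_all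
qed

end

section \<open>Blocks, cacti and cancellation in boundary words\<close>

text \<open>A block is a region: \<open>b\<close> lists its corner labels cyclically,
  \<open>t\<close> is the factor of the first one, \<open>f\<close> is the surplus. In
  \<open>block_glue\<close> the two regions traverse the common edge in opposite directions, so the
  corner before the edge in one meets the corner after it in the other. In \<open>block_fold\<close>
  the two edges at a corner of label \<one> are identified and the corner becomes an interior
  vertex. \<open>block_digon\<close> excludes spheres: folding a digon would close the
  surface.\<close>

locale blocks = two_subgroups +
  fixes block :: "bool \<Rightarrow> 'a list \<Rightarrow> nat \<Rightarrow> bool"
  assumes block_alternating: "block t b f \<Longrightarrow> alternating t b"
    and block_even: "block t b f \<Longrightarrow> even (length b)"
    and block_size: "block t b f \<Longrightarrow> 2 * f + 2 \<le> length b"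
    and block_rotate1: "block t (x # b) f \<Longrightarrow> block (\<not> t) (b @ [x]) f"
    and block_glue: "block t (s # u # b) f \<Longrightarrow> block (\<not> t) (w # z # b') f' \<Longrightarrow>
          block (\<not> t) ((w \<otimes> u) # b @ (s \<otimes> z) # b') (f + f')"
    and block_fold: "block t (x # \<one> # y # b) f \<Longrightarrow> block t ((x \<otimes> y) # b) f"
    and block_digon: "block t [x, \<one>] f \<Longrightarrow> x = \<one> \<and> f = 0"
    and block_tail: "block t [\<one>, \<one>] 0"
begin

lemma block_rotate: "block t (p @ q) f \<Longrightarrow> t' = (t = even (length p)) \<Longrightarrow> block t' (q @ p) f"
proof (induction p arbitrary: t q)
  case (Cons x p)
  have "block (\<not> t) (p @ (q @ [x])) f" using block_rotate1 Cons.prems by fastforce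
  from Cons.IH[OF this] show ?case using Cons.prems(2) by auto
qed simp

text \<open>
  \<open>cactus ws e\<close>: the boundary word \<open>ws\<close>, whose letters lie alternately in \<open>H True\<close> and
  \<open>H False\<close>, bounds a tree-like arrangement of blocks of total surplus \<open>e\<close>. Inserting \<open>[\<one>, \<one>]\<close> attaches an
  edge that is traversed back and forth.
\<close>

inductive cactus :: "'a list \<Rightarrow> nat \<Rightarrow> bool" where
  cactus_one: "cactus [\<one>] 0"
| cactus_insert: "cactus (us @ (x \<otimes> y) # vs) e \<Longrightarrow> x \<in> H (even (length us)) \<Longrightarrow> y \<in> H (even (length us)) \<Longrightarrow>
    block (even (length us)) (d # cs) f \<Longrightarrow> cactus (us @ (x \<otimes> d) # cs @ y # vs) (e + f)"

lemma cactus_alternating: "cactus ws e \<Longrightarrow> alternating True ws"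
proof (induction rule: cactus.induct)
  case (cactus_insert us x y vs e d cs f)
  have "alternating (even (length us)) (d # cs)" "even (length (d # cs))"
    using block_alternating[OF cactus_insert.hyps(4)] block_even[OF cactus_insert.hyps(4)] by blast+
  with cactus_insert.IH cactus_insert.hyps(2,3) show ?case by auto
qed simp

text \<open>An insertion lengthens the word by the length of the block, at least
  \<open>2 * f + 2\<close>. The word \<open>[\<one>]\<close> supplies the remaining 1.\<close>

lemma cactus_size: "cactus ws e \<Longrightarrow> ws = [\<one>] \<and> e = 0 \<or> 2 * e + 3 \<le> length ws"
proof (induction rule: cactus.induct)
  case (cactus_insert us x y vs e d cs f)
  have "2 * e + 1 \<le> length (us @ (x \<otimes> y) # vs)"
    using cactus_insert.IH by (elim disjE) simp_all
  then show ?case using block_size[OF cactus_insert.hyps(4)] by simp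
qed simp

text \<open>The introduction rule with its list equations as separate premises, so that regrouped
  words are matched by simplification.\<close>

lemma cactus_insertI:
  assumes "cactus ws e" "block t (d # cs) f" "x \<in> H t" "y \<in> H t"
    "ws = us @ (x \<otimes> y) # vs" "t = even (length us)" "e' = e + f"
    "ws' = us @ (x \<otimes> d) # cs @ y # vs"
  shows "cactus ws' e'"
  using assms cactus.cactus_insert[of us x y vs e d cs f] by simp

text \<open>Gluing a block from outside along an edge of the boundary word.\<close>

lemma cactus_glue:
  assumes "cactus ws e" "ws = us @ w # z # vs" "block (odd (length us)) (s # u # b) f"
  shows "cactus (us @ (w \<otimes> u) # b @ (s \<otimes> z) # vs) (e + f)"
  using assms
proof (induction arbitrary: us w z vs rule: cactus.induct)
  case (cactus_insert us' x y vs' e d cs f')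
  define t where "t = even (length us')"
  have xy: "x \<in> H t" "y \<in> H t" and block: "block t (d # cs) f'"
    using cactus_insert.hyps by (simp_all add: t_def)
  have d: "d \<in> H t" "alternating (\<not> t) cs" "odd (length cs)" "cs \<noteq> []"
    using block_alternating[OF block] block_even[OF block] by auto
  have block2: "block (odd (length us)) (s # u # b) f" by fact
  have su: "s \<in> H (odd (length us))" "u \<in> H (even (length us))"
      "alternating (odd (length us)) b" "even (length b)"
    using block_alternating[OF block2] block_even[OF block2] by simp_all
  note base = cactus_insert.hyps(1)
  \<comment> \<open>The edge from \<open>w\<close> to \<open>z\<close> is located relative to the
    block inserted last: before it, on it, or after it.\<close>
  from cactus_insert.prems(1)[symmetric] show ?case
  proof (cases rule: pair_split)
    case (L r)
    have "cactus (us @ (w \<otimes> u) # b @ (s \<otimes> z) # r @ (x \<otimes> y) # vs') (e + f)"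
      by (rule cactus_insert.IH) (use L block2 in auto)
    then show ?thesis
      by (rule cactus_insertI[OF _ block xy, where us = "us @ (w \<otimes> u) # b @ (s \<otimes> z) # r" and vs = vs'])
        (use L su in \<open>auto simp: t_def\<close>)
  next
    case M
    then have t: "t = odd (length us)" by (simp add: t_def)
    \<comment> \<open>The edge ends at the vertex where the block is attached; \<open>s\<close> is
      absorbed by the piece \<open>x\<close> of the corner there.\<close>
    have "cactus (us @ (w \<otimes> u) # b @ (s \<otimes> (x \<otimes> y)) # vs') (e + f)"
      by (rule cactus_insert.IH) (use M block2 in auto)
    then show ?thesis
      by (rule cactus_insertI[OF _ block _ xy(2), where us = "us @ (w \<otimes> u) # b" and x = "s \<otimes> x" and vs = vs'])
        (use M su xy d t in \<open>auto simp: H_assoc\<close>)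
  next
    case R: (R r)
    show ?thesis
    proof (cases r)
      case Nil
      then obtain cs' where cs: "cs = z # cs'" "w = x \<otimes> d" "vs = cs' @ y # vs'" "us = us'"
        using R d by (cases cs) auto
      \<comment> \<open>The edge is the first edge of the inserted block, so the two blocks are
        merged and the result is inserted in its place.\<close>
      have "block t ((d \<otimes> u) # b @ (s \<otimes> z) # cs') (f + f')"
        using block_glue[of "\<not> t" s u b f d z cs' f'] block block2 cs by (simp add: t_def)
      then show ?thesis
            by (rule cactus_insertI[OF base _ xy, where us = us' and vs = vs']) (use cs d xy su in \<open>simp_all add: t_def H_assoc\<close>)
    next
      case (Cons v r')
      then have v: "v = x \<otimes> d" "us = us' @ (x \<otimes> d) # r'" "r' @ w # z # vs = cs @ y # vs'" using R by auto
      from v(3) show ?thesis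
      proof (cases rule: pair_split)
        case (L q)
        have "block (even (length us)) (w # z # q @ d # r') f'"
          using block_rotate[of t "d # r'" "w # z # q" f'] L v block by (simp add: t_def)
        with block2 have "block (even (length us)) ((w \<otimes> u) # b @ (s \<otimes> z) # q @ d # r') (f + f')"
          using block_glue[of "odd (length us)"] by simp
        then have "block t (d # r' @ (w \<otimes> u) # b @ (s \<otimes> z) # q) (f + f')"
          using d su L v block_rotate[of "even (length us)" "(w \<otimes> u) # b @ (s \<otimes> z) # q" "d # r'" "f + f'" t]
          by (auto simp: t_def)
        then show ?thesis
            by (rule cactus_insertI[OF base _ xy, where us = us' and vs = vs']) (use v L in \<open>simp_all add: t_def\<close>)
      next
        case M
        have "block (even (length us)) (w # d # r') f'"
          using block_rotate[of t "d # r'" "[w]" f'] M v block by (simp add: t_def)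
        with block2 have "block (even (length us)) ((w \<otimes> u) # b @ (s \<otimes> d) # r') (f + f')"
          using block_glue[of "odd (length us)"] by simp
        then have B: "block t ((s \<otimes> d) # r' @ (w \<otimes> u) # b) (f + f')"
          using d su M v block_rotate[of "even (length us)" "(w \<otimes> u) # b" "(s \<otimes> d) # r'" "f + f'" t]
          by (auto simp: t_def)
        have s: "s \<in> H t" using d su M v by (simp add: t_def)
        \<comment> \<open>The edge is the last one of the block, so the attaching corner changes
          from \<open>d\<close> to \<open>s \<otimes> d\<close>. Splitting the outer corner as
          \<open>x \<otimes> inv s\<close> and \<open>s \<otimes> y\<close> leaves the letter
          \<open>x \<otimes> d\<close> unchanged.\<close>
        show ?thesis
          by (rule cactus_insertI[OF base B, where x = "x \<otimes> inv s" and y = "s \<otimes> y" and us = us' and vs = vs'])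
            (use v M s d xy in \<open>simp_all add: t_def mult_inv_mult\<close>)
      next
        case (R q)
        show ?thesis
        proof (cases q)
          case Nil
          then have t: "t = even (length us)" using R v d by (simp add: t_def)
          \<comment> \<open>The edge starts at the attaching vertex, just after the block;
            \<open>u\<close> is absorbed by the piece \<open>y\<close>.\<close>
          have "cactus (us' @ ((x \<otimes> y) \<otimes> u) # b @ (s \<otimes> z) # vs) (e + f)"
            by (rule cactus_insert.IH) (use R v block2 t Nil in \<open>auto simp: t_def\<close>)
          then show ?thesis
            by (rule cactus_insertI[OF _ block xy(1), where y = "y \<otimes> u" and us = us' and vs = "b @ (s \<otimes> z) # vs"])
              (use su d v R Nil xy t in \<open>simp_all add: H_assoc t_def\<close>)
        next
          case (Cons y' q')
          have "cactus ((us' @ (x \<otimes> y) # q') @ (w \<otimes> u) # b @ (s \<otimes> z) # vs) (e + f)"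
            by (rule cactus_insert.IH) (use R v block2 Cons d in auto)
          then show ?thesis
            by (rule cactus_insertI[OF _ block xy, where us = us' and vs = "q' @ (w \<otimes> u) # b @ (s \<otimes> z) # vs"])
              (use R v Cons d in \<open>auto simp: t_def\<close>)
        qed
      qed
    qed
  qed
qed (simp add: Cons_eq_append_conv)

text \<open>The two edges at the trivial letter are folded together. If both lie outside the block
  inserted last, the induction hypothesis applies; if both lie on it, this is
  \<open>block_fold\<close>. If only one lies on it, the fold identifies an edge of the block with
  an outer edge, which is \<open>cactus_glue\<close>.\<close>

lemma cactus_reduce:
  assumes "cactus ws e" "ws = us @ w # \<one> # z # vs"
  shows "cactus (us @ (w \<otimes> z) # vs) e"
  using assms
proof (induction arbitrary: us w z vs rule: cactus.induct)
  case (cactus_insert us' x y vs' e d cs f)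
  define t where "t = even (length us')"
  have xy: "x \<in> H t" "y \<in> H t" and block: "block t (d # cs) f"
    using cactus_insert.hyps by (simp_all add: t_def)
  have d: "d \<in> H t" "alternating (\<not> t) cs" "odd (length cs)" "cs \<noteq> []"
    using block_alternating[OF block] block_even[OF block] by auto
  note base = cactus_insert.hyps(1)
  have al: "alternating True (us' @ (x \<otimes> y) # vs')" by (rule cactus_alternating[OF base])
  from cactus_insert.prems[symmetric] show ?case
  proof (cases rule: triple_split)
    case (L r)
    have "cactus (us @ (w \<otimes> z) # r @ (x \<otimes> y) # vs') e"
      by (rule cactus_insert.IH) (use L in auto)
    then show ?thesis
      by (rule cactus_insertI[OF _ block xy, where us = "us @ (w \<otimes> z) # r" and vs = vs']) (use L in \<open>auto simp: t_def\<close>)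
  next
    case M1
    have C: "cactus (us @ (w \<otimes> (x \<otimes> y)) # vs') e"
      by (rule cactus_insert.IH) (use M1 in auto)
    have "w \<in> H t" using al M1 by (simp add: t_def)
    then show ?thesis
      by (intro cactus_insertI[OF C block _ xy(2), where us = us and x = "w \<otimes> x" and vs = vs'])
        (use M1 xy d in \<open>simp_all add: H_assoc t_def\<close>)
  next
    case M2
    then obtain cs' where cs: "cs = z # cs'" "vs = cs' @ y # vs'" "x \<otimes> d = \<one>" using d by (cases cs) auto
    \<comment> \<open>The trivial letter is \<open>x \<otimes> d\<close>, between an outer edge and
      the first edge of the block. Instead of being inserted, the block is glued along that outer
      edge.\<close>
    have "cactus (us @ (w \<otimes> z) # cs' @ (d \<otimes> (x \<otimes> y)) # vs') (e + f)"
      by (rule cactus_glue[OF base]) (use M2 cs block in \<open>auto simp: t_def\<close>)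
    moreover
    have "d \<otimes> (x \<otimes> y) = y"
    proof -
      have "d \<otimes> x = \<one>" using inv_comm[OF cs(3)] xy(1) d(1) by (simp add: H_carrier)
      then have "d \<otimes> x \<otimes> y = y" using xy by (simp add: H_carrier)
      then show ?thesis using H_assoc[of d t x y] xy d by simp
    qed
    ultimately show ?thesis using cs by simp
  next
    case R: (R r)
    show ?thesis
    proof (cases r)
      case Nil
      then have us: "us = us'" "w = x \<otimes> d" using R by auto
      obtain cs' where cs: "cs = \<one> # cs'" "z # vs = cs' @ y # vs'" using R Nil d by (cases cs) auto
      show ?thesis
      proof (cases cs')
        case Nil
        \<comment> \<open>Folding would close up the whole block, so the block is a bare edge and
          disappears.\<close>
        then have "d = \<one>" "f = 0" using block_digon[of t d f] block cs by auto
        then show ?thesis using base us cs Nil xy by (simp add: H_carrier)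
      next
        case (Cons z' q)
        with cs block have "block t (d # \<one> # z # q) f" by simp
        from block_fold[OF this] have B: "block t ((d \<otimes> z) # q) f" .
        have "z \<in> H t" using d cs Cons by auto
        then show ?thesis
          by (intro cactus_insertI[OF base B xy, where us = us' and vs = vs']) (use us cs Cons xy d in \<open>auto simp: t_def H_assoc\<close>)
      qed
    next
      case (Cons v r')
      then have v: "us = us' @ (x \<otimes> d) # r'" "r' @ w # \<one> # z # vs = cs @ y # vs'" using R by auto
      from v(2) show ?thesis
      proof (cases rule: triple_split)
        case (L q)
        have "block (even (length us)) (w # \<one> # z # q @ d # r') f"
          using block_rotate[of t "d # r'" "w # \<one> # z # q" f] L v block by (simp add: t_def)
        from block_fold[OF this] have "block t (d # r' @ (w \<otimes> z) # q) f"
          using d L v block_rotate[of "even (length us)" "(w \<otimes> z) # q" "d # r'" f t] by (auto simp: t_def)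
        then show ?thesis
            by (rule cactus_insertI[OF base _ xy, where us = us' and vs = vs']) (use v L in \<open>simp_all add: t_def\<close>)
      next
        case M1
        have "block (even (length us)) (w # \<one> # d # r') f"
          using block_rotate[of t "d # r'" "[w, \<one>]" f] M1 v block by (simp add: t_def)
        from block_fold[OF this] have B: "block t ((w \<otimes> d) # r') f"
          using d M1 v by (simp add: t_def)
        have w: "w \<in> H t" using d M1 v by (simp add: t_def)
        \<comment> \<open>As the attaching corner absorbs \<open>w\<close>, the outer corner is
          split anew to compensate.\<close>
        show ?thesis
          by (rule cactus_insertI[OF base B, where x = "x \<otimes> inv w" and y = "w \<otimes> y" and us = us' and vs = vs'])
            (use v M1 w d xy in \<open>simp_all add: t_def mult_inv_mult\<close>)
      next
        case M2
        \<comment> \<open>Here \<open>y\<close> is the trivial letter: the last edge of the block is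
          identified with the outer edge that follows it.\<close>
        have t: "t = odd (length us)" using d M2 v by (simp add: t_def)
        have "block (even (length us)) (w # d # r') f"
          using block_rotate[of t "d # r'" "[w]" f] M2 v block by (simp add: t_def)
        then have "cactus (us' @ (x \<otimes> d) # r' @ (w \<otimes> z) # vs) (e + f)"
          using cactus_glue[OF base, of us' "x" z vs w d r' f] M2 v d xy t by (simp add: t_def H_carrier)
        then show ?thesis using v by simp
      next
        case (R q)
        show ?thesis
        proof (cases q)
          case Nil
          then have t: "t = even (length us)" using R v d by (simp add: t_def)
          have eq: "w = y" "vs' = \<one> # z # vs" using R Nil by auto
          have z: "z \<in> H t" using al eq by (simp add: t_def)
          have "cactus (us' @ ((x \<otimes> y) \<otimes> z) # vs) e"
            by (rule cactus_insert.IH) (use eq in auto)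
          then show ?thesis
            by (rule cactus_insertI[OF _ block xy(1), where y = "y \<otimes> z" and us = us' and vs = vs])
              (use d v R Nil xy z eq in \<open>simp_all add: H_assoc t_def\<close>)
        next
          case (Cons y' q')
          have "cactus ((us' @ (x \<otimes> y) # q') @ (w \<otimes> z) # vs) e"
            by (rule cactus_insert.IH) (use R v Cons in auto)
          then show ?thesis
            by (rule cactus_insertI[OF _ block xy, where us = us' and vs = "q' @ (w \<otimes> z) # vs"])
              (use R v Cons in \<open>auto simp: t_def\<close>)
        qed
      qed
    qed
  qed
next
  case cactus_one
  then have "length [\<one>] = length (us @ w # \<one> # z # vs)" by (rule arg_cong)
  then show ?case by simp
qed

text \<open>Each fold shortens the word and keeps its product and surplus. The first and the last
  letter may remain trivial, since the word is cut open at its base vertex.\<close>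

lemma cactus_reduced:
  "cactus ws e \<Longrightarrow> \<exists>ws'. cactus ws' e \<and> list_prod G ws' = list_prod G ws \<and>
     \<one> \<notin> set (butlast (tl ws'))"
proof (induction "length ws" arbitrary: ws rule: less_induct)
  case less
  show ?case
  proof (cases "\<exists>us w z vs. ws = us @ w # \<one> # z # vs")
    case True
    then obtain us w z vs where ws: "ws = us @ w # \<one> # z # vs" by blast
    have red: "cactus (us @ (w \<otimes> z) # vs) e" by (rule cactus_reduce[OF less.prems ws])
    have "set ws \<subseteq> carrier G" by (rule alternating_carrier[OF cactus_alternating[OF less.prems]])
    then have "list_prod G (us @ (w \<otimes> z) # vs) = list_prod G ws"
      using ws by (simp add: m_assoc)
    moreover have "length (us @ (w \<otimes> z) # vs) < length ws" using ws by simp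
    ultimately show ?thesis using less.hyps[OF _ red] by simp
  next
    case False
    then have "\<one> \<notin> set (butlast (tl ws))" 
      by (intro notI) (erule mem_interiorD, use False in blast)
    with less.prems show ?thesis by (intro exI[of _ ws] conjI refl)
  qed
qed

text \<open>The letters of \<open>gs\<close> are laid out along a chain of tails, and the block
  hangs at its end: the way out spells \<open>gs\<close>, the way back its inverse. A letter that
  does not belong to the factor of the current vertex costs one extra tail.\<close>

lemma cactus_insert_conjugate:
  assumes "cactus (us @ z # vs) e" "block True b f" "set gs \<subseteq> H True \<union> H False"
  shows "\<exists>ws. cactus ws (e + f) \<and> list_prod G ws =
    list_prod G us \<otimes> z \<otimes> (list_prod G gs \<otimes> list_prod G b \<otimes> inv (list_prod G gs)) \<otimes> list_prod G vs"
  using assms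
proof (induction gs arbitrary: us z vs)
  case Nil
  have al: "alternating True (us @ z # vs)" by (rule cactus_alternating) fact
  have car: "set us \<subseteq> carrier G" "z \<in> carrier G" "set vs \<subseteq> carrier G" "set b \<subseteq> carrier G"
    using alternating_carrier[OF al] alternating_carrier[OF block_alternating[OF Nil(2)]] by simp_all
  obtain d cs where b: "b = d # cs" using block_size[OF Nil(2)] by (cases b) auto
  show ?case
  proof (cases "even (length us)")
    case True
    have "cactus (us @ (z \<otimes> d) # cs @ \<one> # vs) (e + f)"
      by (rule cactus_insertI[OF Nil(1), where x = z and y = \<one> and us = us and vs = vs and t = True])
        (use Nil b True al car in simp_all)
    then show ?thesis using car b by (intro exI conjI) (auto simp: m_assoc)
  next
    case False
    \<comment> \<open>The block starts in \<open>H True\<close>; at a vertex of the other factor a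
      tail comes first and the block hangs at its far end.\<close>
    have "cactus (us @ (z \<otimes> \<one>) # [\<one>] @ \<one> # vs) e"
      by (rule cactus_insertI[OF Nil(1) block_tail[of False], where x = z and y = \<one> and us = us and vs = vs])
        (use False al car in simp_all)
    then have C: "cactus ((us @ [z]) @ \<one> # \<one> # vs) e" using car by simp
    have "d \<in> carrier G" "set cs \<subseteq> carrier G" using car(4) b by simp_all
    have "block True (d # cs) f" using Nil(2) b by simp
    from cactus_insertI[OF C this, where x = \<one> and y = \<one> and us = "us @ [z]" and vs = "\<one> # vs"]
    have "cactus (us @ z # d # cs @ \<one> # \<one> # vs) (e + f)"
      using False \<open>d \<in> carrier G\<close> by simp
    then show ?thesis
      using car b by (intro exI[of _ "us @ z # d # cs @ \<one> # \<one> # vs"]) (simp add: m_assoc)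
  qed
next
  case (Cons l gs)
  have al: "alternating True (us @ z # vs)" by (rule cactus_alternating) fact
  have car: "set us \<subseteq> carrier G" "z \<in> carrier G" "set vs \<subseteq> carrier G" "set b \<subseteq> carrier G"
    using alternating_carrier[OF al] alternating_carrier[OF block_alternating[OF Cons.prems(2)]] by simp_all
  have carl: "l \<in> carrier G" "set gs \<subseteq> carrier G"
    using Cons.prems(3) by (auto dest: H_carrier)
  show ?case
  proof (cases "l \<in> H (even (length us))")
    case True
    have "cactus (us @ ((z \<otimes> l) \<otimes> \<one>) # [\<one>] @ inv l # vs) e"
      by (rule cactus_insertI[OF Cons.prems(1) block_tail[of "even (length us)"],
            where x = "z \<otimes> l" and y = "inv l" and us = us and vs = vs])
        (use True al car carl in \<open>simp_all add: m_assoc\<close>)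
    then have "cactus ((us @ [z \<otimes> l]) @ \<one> # inv l # vs) e" using car carl by simp
    from Cons.IH[OF this Cons.prems(2)] obtain ws where "cactus ws (e + f)"
      "list_prod G ws = list_prod G (us @ [z \<otimes> l]) \<otimes> \<one> \<otimes>
        (list_prod G gs \<otimes> list_prod G b \<otimes> inv (list_prod G gs)) \<otimes> list_prod G (inv l # vs)"
      using Cons.prems(3) by auto
    then show ?thesis using car carl by (intro exI[of _ ws]) (simp add: m_assoc inv_mult_group)
  next
    case False
    then have l: "l \<in> H (odd (length us))" using Cons.prems(3) by (cases "even (length us)") auto
    have "cactus (us @ (z \<otimes> \<one>) # [\<one>] @ \<one> # vs) e"
      by (rule cactus_insertI[OF Cons.prems(1) block_tail[of "even (length us)"],
            where x = z and y = \<one> and us = us and vs = vs])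
        (use al car in simp_all)
    then have C: "cactus ((us @ [z]) @ \<one> # \<one> # vs) e" using car by simp
    have "cactus ((us @ [z]) @ (l \<otimes> \<one>) # [\<one>] @ inv l # \<one> # vs) e"
      by (rule cactus_insertI[OF C block_tail[of "odd (length us)"],
            where x = l and y = "inv l" and us = "us @ [z]" and vs = "\<one> # vs"])
        (use l car carl in simp_all)
    then have "cactus ((us @ [z, l]) @ \<one> # inv l # \<one> # vs) e" using car carl by simp
    from Cons.IH[OF this Cons.prems(2)] obtain ws where "cactus ws (e + f)"
      "list_prod G ws = list_prod G (us @ [z, l]) \<otimes> \<one> \<otimes>
        (list_prod G gs \<otimes> list_prod G b \<otimes> inv (list_prod G gs)) \<otimes> list_prod G (inv l # \<one> # vs)"
      using Cons.prems(3) by auto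
    then show ?thesis using car carl by (intro exI[of _ ws]) (simp add: m_assoc inv_mult_group)
  qed
qed

lemma cactus_mult_conjugate:
  assumes "cactus ws e" "block True b f" "set gs \<subseteq> H True \<union> H False"
  shows "\<exists>ws'. cactus ws' (e + f) \<and> list_prod G ws' =
    list_prod G ws \<otimes> (list_prod G gs \<otimes> list_prod G b \<otimes> inv (list_prod G gs))"
proof -
  have ws: "ws \<noteq> []" using cactus_size[OF assms(1)] by auto
  have "set ws \<subseteq> carrier G" by (rule alternating_carrier[OF cactus_alternating[OF assms(1)]])
  then have car: "set (butlast ws) \<subseteq> carrier G" "last ws \<in> carrier G"
    using ws by (auto dest: in_set_butlastD)
  have eq: "butlast ws @ last ws # [] = ws" using ws by simp
  have "list_prod G ws = list_prod G (butlast ws) \<otimes> last ws"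
    by (subst eq[symmetric], subst list_prod_append) (use car in simp_all)
  moreover have "list_prod G gs \<otimes> list_prod G b \<otimes> inv (list_prod G gs) \<in> carrier G"
    using alternating_carrier[OF block_alternating[OF assms(2)]] assms(3) H_carrier
    by (intro m_closed inv_closed list_prod_closed) blast+
  ultimately show ?thesis
    using cactus_insert_conjugate[of "butlast ws" "last ws" "[]" e b f gs] assms car eq by simp
qed

end

section \<open>Ascents and wraps of discs\<close>

fun ascents :: "nat list \<Rightarrow> nat" where
  "ascents (x # y # zs) = of_bool (x < y) + ascents (y # zs)"
| "ascents _ = 0"

lemma ascents_append:
  "xs \<noteq> [] \<Longrightarrow> ys \<noteq> [] \<Longrightarrow> ascents (xs @ ys) = ascents xs + ascents ys + of_bool (last xs < hd ys)"
  by (induction xs rule: ascents.induct) (cases ys; simp)+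

text \<open>Without ascents the list is weakly decreasing, so it can return to its first value only
  by being constant.\<close>

lemma constant_if_no_ascents:
  "ascents (x # xs) = 0 \<Longrightarrow> last (x # xs) \<le> x \<and> (x \<le> last (x # xs) \<longrightarrow> set xs \<subseteq> {x})"
proof (induction xs arbitrary: x)
  case (Cons y xs)
  then have "y \<le> x" "last (y # xs) \<le> y" "y \<le> last (y # xs) \<longrightarrow> set xs \<subseteq> {y}"
    by (auto split: if_splits)
  then show ?case by auto
qed simp

text \<open>The letters of a cyclically reduced word that starts in \<open>H True\<close> and ends
  in \<open>H False\<close>. Torsion freeness is present here only as \<open>c_pow\<close>.\<close>

locale cyclic_word = two_subgroups +
  fixes n :: nat and c :: "nat \<Rightarrow> 'a"
  assumes n_pos: "0 < n" and n_even: "even n"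
    and c_mem: "s < n \<Longrightarrow> c s \<in> H (even s)"
    and c_pow: "s < n \<Longrightarrow> 0 < r \<Longrightarrow> c s [^] (r::nat) \<noteq> \<one>"
begin

lemma c_carrier: "s < n \<Longrightarrow> c s \<in> carrier G"
  using c_mem H_carrier by blast

text \<open>
  A region of the diagram is given by its boundary corners, each being the list of the indices of the face corners
  it is made of. The edge after a corner \<open>S\<close> belongs to a face as its edge number \<open>last S\<close>.
\<close>

definition corner :: "nat list \<Rightarrow> bool" where
  "corner S \<longleftrightarrow> S \<noteq> [] \<and> set S \<subseteq> {..<n} \<and> (\<exists>t. \<forall>s \<in> set S. even s = t)"

definition label :: "nat list \<Rightarrow> 'a" where
  "label S = list_prod G (map c S)"

text \<open>The face along the edge after \<open>S\<close> also has a corner at the far end of that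
  edge, and corners of a face are numbered modulo \<open>n\<close>.\<close>

definition link :: "nat list \<Rightarrow> nat list \<Rightarrow> bool" where
  "link S T \<longleftrightarrow> hd T = Suc (last S) mod n"

definition wrap :: "nat list \<Rightarrow> nat" where
  "wrap S = of_bool (Suc (last S) = n)"

text \<open>The repeated first corner closes the boundary cyclically. The inequality is the strict
  one between ascents and wraps, with margin \<open>e\<close>.\<close>

definition disc :: "nat list list \<Rightarrow> nat \<Rightarrow> bool" where
  "disc Ss e \<longleftrightarrow> Ss \<noteq> [] \<and> list_all corner Ss \<and> successively link (Ss @ [hd Ss]) \<and>
     sum_list (map ascents Ss) + 1 + e \<le> sum_list (map wrap Ss)"

text \<open>The bare edge \<open>[\<one>, \<one>]\<close> is a separate case because it borders no
  face, so its corners have no indices.\<close>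

definition block :: "bool \<Rightarrow> 'a list \<Rightarrow> nat \<Rightarrow> bool" where
  "block t b e \<longleftrightarrow> (\<exists>Ss. disc Ss e \<and> even (hd (hd Ss)) = t \<and> b = map label Ss) \<or> b = [\<one>, \<one>] \<and> e = 0"

lemma corner_mem: "corner S \<Longrightarrow> s \<in> set S \<Longrightarrow> s < n \<and> even s = even (hd S)"
  unfolding corner_def using hd_in_set by blast

lemma corner_last: "corner S \<Longrightarrow> last S < n \<and> even (last S) = even (hd S)"
  by (rule corner_mem) (simp_all add: corner_def)

lemma corner_append:
  assumes "corner S" "corner T" "even (hd S) = even (hd T)"
  shows "corner (S @ T)"
proof -
  have "even s = even (hd S)" if "s \<in> set (S @ T)" for s
    using that corner_mem[OF assms(1), of s] corner_mem[OF assms(2), of s] assms(3) by auto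
  then have "\<exists>t. \<forall>s \<in> set (S @ T). even s = t" by blast
  then show ?thesis using assms(1,2) by (simp add: corner_def)
qed

lemma label_mem:
  assumes "corner S"
  shows "label S \<in> H (even (hd S))"
proof -
  have "label T \<in> H (even (hd S))" if "set T \<subseteq> set S" for T
    using that
  proof (induction T)
    case (Cons s T)
    then have "c s \<in> H (even (hd S))" using c_mem[of s] corner_mem[OF assms, of s] by simp
    then show ?case using Cons by (simp add: label_def)
  qed (simp add: label_def)
  then show ?thesis by simp
qed

lemma label_append: "corner S \<Longrightarrow> corner T \<Longrightarrow> label (S @ T) = label S \<otimes> label T"
  unfolding label_def map_append
  by (rule list_prod_append) (auto simp: corner_def c_carrier)

text \<open>The second summand closes the count around the vertex. With no ascent at all the indices
  are constant, and the label is a positive power of one letter, contrary to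
  \<open>c_pow\<close>.\<close>

lemma closed_corner_ascent:
  assumes "corner S" "label S = \<one>"
  shows "1 \<le> ascents S + of_bool (last S < hd S)"
proof (rule ccontr)
  assume contr: "\<not> ?thesis"
  obtain s xs where S: "S = s # xs" using assms(1) by (cases S) (auto simp: corner_def)
  have "ascents (s # xs) = 0" "\<not> last (s # xs) < s" using contr S by auto
  then have "set S \<subseteq> {s}" using constant_if_no_ascents[of s xs] S by (simp del: last.simps)
  then have "S = replicate (length S) s" by (simp add: subset_iff replicate_eqI)
  moreover have "s < n" using assms(1) S by (simp add: corner_def)
  moreover have "list_prod G (map c (replicate k s)) = c s [^] k" for k
  proof (induction k)
    case (Suc k)
    then show ?case using nat_pow_Suc2[OF c_carrier[OF \<open>s < n\<close>], of k] by simp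
  qed simp
  ultimately have "label S = c s [^] length S" unfolding label_def by metis
  then show False using assms(2) c_pow[OF \<open>s < n\<close>, of "length S"] S by simp
qed

text \<open>As \<open>n\<close> is even, the step from \<open>n - 1\<close> back to 0 changes the
  parity too.\<close>

lemma link_parity: "corner S \<Longrightarrow> link S T \<Longrightarrow> even (hd T) = odd (hd S)"
  using n_even corner_last[of S] by (cases "Suc (last S) = n") (auto simp: link_def)

text \<open>Of the two ends of an edge exactly one is an ascent, unless one of its sides wraps around.\<close>

lemma edge_ascents:
  assumes "corner S" "corner T" "even (hd S) = odd (hd T)" "link S U" "link T V"
  shows "of_bool (last T < hd U) + of_bool (last S < hd V) + wrap S + wrap T = (1::nat)"
  \<comment> \<open>The two sides start from opposite ends of the edge, so \<open>last S\<close> and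
    \<open>last T\<close> differ in parity. For unequal numbers exactly one of
    \<open>last T < Suc (last S)\<close> and \<open>last S < Suc (last T)\<close> holds; a wrap
    makes both comparisons fail, and only one side can wrap.\<close>
  using assms corner_last[of S] corner_last[of T] n_pos
  by (cases "Suc (last S) = n"; cases "Suc (last T) = n"; cases "last S = last T")
    (auto simp: link_def wrap_def of_bool_def)

text \<open>A link sees only the last index of its first corner and the first index of its second,
  so corners at the ends may be extended outwards.\<close>

lemma successively_link_ends:
  assumes "successively link (U # Us @ [S])" "last X = last U" "hd Y = hd S"
  shows "successively link (X # Us @ [Y])"
  using assms by (cases Us rule: rev_cases)
    (auto simp: link_def successively_Cons successively_append_iff hd_append split: if_splits)

lemma disc_rotate: "disc (S # Us) e \<Longrightarrow> disc (Us @ [S]) e"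
  by (cases Us) (auto simp: disc_def successively_append_iff successively_Cons hd_append split: if_splits)

text \<open>Parity changes along every link. The index \<open>n - 1\<close> is odd, so only every
  second corner can wrap, which gives the second bound.\<close>

lemma disc_alternating:
  assumes "successively link Ss" "list_all corner Ss" "Ss \<noteq> [] \<longrightarrow> even (hd (hd Ss)) = t"
  shows "alternating t (map label Ss)"
    and "2 * sum_list (map wrap Ss) \<le> (if t then length Ss else Suc (length Ss))"
    and "Ss \<noteq> [] \<longrightarrow> even (hd (last Ss)) = (t = odd (length Ss))"
proof -
  have "alternating t (map label Ss) \<and>
      2 * sum_list (map wrap Ss) \<le> (if t then length Ss else Suc (length Ss)) \<and>
      (Ss \<noteq> [] \<longrightarrow> even (hd (last Ss)) = (t = odd (length Ss)))"
    using assms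
  proof (induction Ss arbitrary: t)
    case (Cons S Ss)
    have IH: "alternating (\<not> t) (map label Ss)"
      "2 * sum_list (map wrap Ss) \<le> (if \<not> t then length Ss else Suc (length Ss))"
      "Ss \<noteq> [] \<longrightarrow> even (hd (last Ss)) = ((\<not> t) = odd (length Ss))"
      using Cons.IH[of "\<not> t"] Cons.prems link_parity[of S "hd Ss"] by (auto simp: successively_Cons)
    have "wrap S \<le> of_bool (\<not> t)"
      using Cons.prems corner_last[of S] n_even by (auto simp: wrap_def)
    then show ?case
      using IH Cons.prems label_mem[of S] by (auto split: if_splits)
  qed simp
  then show "alternating t (map label Ss)"
    and "2 * sum_list (map wrap Ss) \<le> (if t then length Ss else Suc (length Ss))"
    and "Ss \<noteq> [] \<longrightarrow> even (hd (last Ss)) = (t = odd (length Ss))"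
    by blast+
qed

lemma discD:
  assumes "disc Ss e"
  shows "Ss \<noteq> []" "list_all corner Ss" "successively link Ss" "link (last Ss) (hd Ss)"
    "sum_list (map ascents Ss) + 1 + e \<le> sum_list (map wrap Ss)"
  using assms by (auto simp: disc_def successively_append_iff)

lemma disc_label_alternating: "disc Ss e \<Longrightarrow> alternating (even (hd (hd Ss))) (map label Ss)"
  by (rule disc_alternating(1)) (simp_all add: discD)

lemma disc_even:
  assumes "disc Ss e"
  shows "even (length Ss)"
proof -
  note D = discD[OF assms]
  have "even (hd (last Ss)) = (even (hd (hd Ss)) = odd (length Ss))"
    using disc_alternating(3)[OF D(3,2) impI[OF refl]] D(1) by blast
  moreover have "corner (last Ss)" using D(1,2) by (simp add: list_all_iff)
  ultimately show ?thesis using link_parity[of "last Ss" "hd Ss"] D(4) by auto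
qed

text \<open>At most half of the corners wrap, while the disc inequality demands at least
  \<open>1 + e\<close> wraps.\<close>

lemma disc_size:
  assumes "disc Ss e"
  shows "2 * e + 2 \<le> length Ss"
proof -
  have "2 * sum_list (map wrap Ss) \<le> Suc (length Ss)"
    using disc_alternating(2)[OF discD(3,2)[OF assms] impI[OF refl]] by (auto split: if_splits)
  with disc_even[OF assms] have "sum_list (map wrap Ss) \<le> length Ss div 2" by presburger
  then show ?thesis using discD(5)[OF assms] disc_even[OF assms] by presburger
qed

text \<open>By \<open>edge_ascents\<close> the common edge costs one unit, as a new ascent or as a
  lost wrap. The inequalities of the two discs bring the margins \<open>1 + e\<close> and
  \<open>1 + f\<close>, so \<open>1 + e + f\<close> remains.\<close>

lemma disc_glue:
  assumes "disc (S # U # Us) e" "disc (W # Z # Zs) f" "even (hd S) = odd (hd W)"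
  shows "disc ((W @ U) # Us @ (S @ Z) # Zs) (e + f)"
proof -
  have corner: "corner S" "corner U" "list_all corner Us" "corner W" "corner Z" "list_all corner Zs"
    and succ: "link S U" "successively link (U # Us @ [S])" "link W Z" "successively link (Z # Zs @ [W])"
    using assms by (auto simp: disc_def)
  have ne: "S \<noteq> []" "U \<noteq> []" "W \<noteq> []" "Z \<noteq> []" using corner by (auto simp: corner_def)
  have par: "even (hd U) = even (hd W)" "even (hd Z) = even (hd S)"
    using link_parity[OF corner(1) succ(1)] link_parity[OF corner(4) succ(3)] assms(3) by auto
  have "successively link ((W @ U) # Us @ [S @ Z])"
    by (rule successively_link_ends[OF succ(2)]) (use ne in auto)
  then have "successively link (((W @ U) # Us) @ [S @ Z])" by simp
  moreover have "successively link ((S @ Z) # Zs @ [W @ U])"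
    by (rule successively_link_ends[OF succ(4)]) (use ne in auto)
  ultimately have "successively link (((W @ U) # Us) @ ((S @ Z) # Zs @ [W @ U]))"
    unfolding successively_append_iff by auto
  moreover have "wrap (W @ U) = wrap U" "wrap (S @ Z) = wrap Z"
    using ne by (simp_all add: wrap_def)
  moreover have "corner (W @ U)" "corner (S @ Z)" using corner par by (simp_all add: corner_append)
  moreover have "of_bool (last W < hd U) + of_bool (last S < hd Z) + wrap S + wrap W = (1::nat)"
    by (rule edge_ascents) (use corner assms(3) succ in auto)
  ultimately show ?thesis
    using discD(5)[OF assms(1)] discD(5)[OF assms(2)] corner
    by (simp add: disc_def ascents_append[OF ne(3,2)] ascents_append[OF ne(1,4)])
qed

text \<open>The identified edge costs one unit as in gluing, with the comparison that closes
  \<open>M\<close> among its two ends. The vertex \<open>M\<close> leaves the boundary and repays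
  the unit by its ascent from \<open>closed_corner_ascent\<close>.\<close>

lemma disc_fold:
  assumes "disc (S # M # U # Us) e" "label M = \<one>"
  shows "disc ((S @ U) # Us) e"
proof -
  have corner: "corner S" "corner M" "corner U" "list_all corner Us"
    and succ: "link S M" "link M U" "successively link (U # Us @ [S])"
    using assms by (auto simp: disc_def)
  have ne: "S \<noteq> []" "M \<noteq> []" "U \<noteq> []" using corner by (auto simp: corner_def)
  have par: "even (hd M) = odd (hd S)" "even (hd U) = even (hd S)"
    using link_parity[OF corner(1) succ(1)] link_parity[OF corner(2) succ(2)] by auto
  have "successively link ((S @ U) # Us @ [S @ U])"
    by (rule successively_link_ends[OF succ(3)]) (use ne in auto)
  moreover have "wrap (S @ U) = wrap U" using ne by (simp add: wrap_def)
  moreover have "of_bool (last M < hd M) + of_bool (last S < hd U) + wrap S + wrap M = (1::nat)"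
    by (rule edge_ascents) (use corner par succ in auto)
  ultimately show ?thesis
    using assms(1) corner par ne closed_corner_ascent[OF corner(2) assms(2)]
    by (auto simp: disc_def ascents_append corner_append)
qed

text \<open>The disc inequality requires a wrap, and this wrap uses up the one unit that
  \<open>edge_ascents\<close> allows. No ascent is left around \<open>M\<close>, so \<open>M\<close>
  cannot be closed.\<close>

lemma disc_digon_label: "disc [S, M] e \<Longrightarrow> label M \<noteq> \<one>"
proof
  assume disc: "disc [S, M] e" and "label M = \<one>"
  then have *: "corner S" "corner M" "link S M" "link M S" by (auto simp: disc_def)
  have "of_bool (last M < hd M) + of_bool (last S < hd S) + wrap S + wrap M = (1::nat)"
    by (rule edge_ascents) (use * link_parity[of S M] in auto)
  then show False
    using disc closed_corner_ascent[OF *(2) \<open>label M = \<one>\<close>] by (auto simp: disc_def)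
qed

sublocale blocks G H block
proof
  show "alternating t b" if "block t b f" for t b f
    using that disc_label_alternating by (auto simp: block_def)
  show "even (length b)" "2 * f + 2 \<le> length b" if "block t b f" for t b f
    using that disc_even disc_size by (auto simp: block_def)
  show rot: "block (\<not> t) (b @ [x]) f" if "block t (x # b) f" for t b f x
  proof (cases "x # b = [\<one>, \<one>] \<and> f = 0")
    case False
    with that obtain S Us where *: "disc (S # Us) f" "even (hd S) = t" "x = label S" "b = map label Us"
      by (auto simp: block_def Cons_eq_map_conv)
    have "2 \<le> length (S # Us)" using disc_size[OF *(1)] by simp
    then obtain U Us' where Us: "Us = U # Us'" by (cases Us) auto
    then have "even (hd U) = (\<not> t)"
      using link_parity[of S U] * by (auto simp: disc_def)
    with disc_rotate[OF *(1)] * Us show ?thesis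
      unfolding block_def by (intro disjI1 exI[of _ "Us @ [S]"]) auto
  qed (simp add: block_def)
  show "block (\<not> t) ((w \<otimes> u) # b @ (s \<otimes> z) # b') (f + f')"
    if 1: "block t (s # u # b) f" and 2: "block (\<not> t) (w # z # b') f'" for t s u b f w z b' f'
  proof -
    have al: "alternating t b" if "block t b f" for t b f
      using that disc_label_alternating by (auto simp: block_def)
    have car: "s \<in> carrier G" "u \<in> carrier G" "w \<in> carrier G" "z \<in> carrier G"
      using al[OF 1] al[OF 2] by (auto simp: H_carrier)
    \<comment> \<open>Gluing on a bare edge changes the other block at most by a rotation; only two
      genuine discs need \<open>disc_glue\<close>.\<close>
    consider (l) "s # u # b = [\<one>, \<one>]" "f = 0" | (r) "w # z # b' = [\<one>, \<one>]" "f' = 0"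
      | (d) Ss Ts where "disc Ss f" "even (hd (hd Ss)) = t" "s # u # b = map label Ss"
          "disc Ts f'" "even (hd (hd Ts)) = (\<not> t)" "w # z # b' = map label Ts"
      using 1 2 unfolding block_def by metis
    then show ?thesis
    proof cases
      case l
      then show ?thesis using 2 car by simp
    next
      case r
      then show ?thesis using rot[OF 1] car by simp
    next
      case d
      obtain S U Us where S: "Ss = S # U # Us" "s = label S" "u = label U" "b = map label Us"
        using d(3) by (auto simp: Cons_eq_map_conv)
      obtain W Z Zs where W: "Ts = W # Z # Zs" "w = label W" "z = label Z" "b' = map label Zs"
        using d(6) by (auto simp: Cons_eq_map_conv)
      note * = S W
      have "corner S" "corner U" "corner W" "corner Z" using d * by (auto simp: disc_def)
      moreover have "disc ((W @ U) # Us @ (S @ Z) # Zs) (f + f')"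
        by (rule disc_glue) (use d * in auto)
      ultimately show ?thesis
        unfolding block_def
        by (intro disjI1 exI[of _ "(W @ U) # Us @ (S @ Z) # Zs"])
          (use d * in \<open>auto simp: label_append corner_def\<close>)
    qed
  qed
  show "block t ((x \<otimes> y) # b) f" if "block t (x # \<one> # y # b) f" for t x y b f
  proof -
    from that obtain S M U Us where *: "disc (S # M # U # Us) f" "even (hd S) = t"
        "x = label S" "label M = \<one>" "y = label U" "b = map label Us"
      by (auto simp: block_def Cons_eq_map_conv)
    then have "corner S" "corner U" by (auto simp: disc_def)
    with * disc_fold[OF *(1,4)] show ?thesis
      unfolding block_def by (intro disjI1 exI[of _ "(S @ U) # Us"]) (auto simp: label_append corner_def)
  qed
  show "x = \<one> \<and> f = 0" if "block t [x, \<one>] f" for t x f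
    using that by (auto simp: block_def Cons_eq_map_conv dest!: disc_digon_label)
  show "block t [\<one>, \<one>] 0" for t by (simp add: block_def)
qed

text \<open>One face with boundary word repeated \<open>k\<close> times: every corner is a single
  index, so there are no ascents, and each period contributes one wrap.\<close>

lemma block_power:
  assumes "0 < k"
  shows "block True (concat (replicate k (map c [0..<n]))) (k - 1)"
proof -
  define Ss where "Ss k = concat (replicate k (map (\<lambda>s. [s]) [0..<n]))" for k
  have one: "Ss (Suc k) = [0] # map (\<lambda>s. [s]) [1..<n] @ Ss k" for k
    using n_pos by (simp add: Ss_def upt_conv_Cons)
  have sing: "successively link (map (\<lambda>s. [s]) [0..<n])"
    by (simp add: successively_conv_nth link_def)
  have last: "last (map (\<lambda>s. [s]) [0..<n]) = [n - 1]" using n_pos by (simp add: last_map)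
  have hd: "hd (Ss k @ [[0]]) = [0]" for k
    by (cases k) (simp add: Ss_def, simp add: one)
  have succ: "successively link (Ss k @ [[0]])" for k
  proof (induction k)
    case (Suc k)
    have "Ss (Suc k) @ [[0]] = map (\<lambda>s. [s]) [0..<n] @ Ss k @ [[0]]" by (simp add: Ss_def)
    moreover have "link [n - 1] [0]" using n_pos by (simp add: link_def)
    ultimately show ?case
      using Suc sing last hd[of k] by (simp add: successively_append_iff)
  qed (simp add: Ss_def)
  have "sum_list (map wrap (map (\<lambda>s. [s]) [0..<m])) = of_bool (m = n)" if "m \<le> n" for m
    using that n_pos by (induction m) (simp_all add: wrap_def)
  then have w1: "sum_list (map wrap (map (\<lambda>s. [s]) [0..<n])) = 1" by simp
  have wrap: "sum_list (map wrap (Ss k)) = k" for k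
    using w1 by (induction k) (simp_all add: Ss_def)
  have asc: "sum_list (map ascents (Ss k)) = 0" for k
    by (induction k) (auto simp: Ss_def)
  have corners: "list_all corner (Ss k)" for k
    by (auto simp: Ss_def list_all_iff corner_def)
  have lab: "map label (Ss k) = concat (replicate k (map c [0..<n]))" for k
    by (induction k) (auto simp: Ss_def label_def c_carrier)
  obtain k' where k: "k = Suc k'" using assms by (cases k) auto
  have "hd (Ss k) = [0]" "Ss k \<noteq> []" by (simp_all add: k one)
  then have "disc (Ss k) (k - 1)"
    using succ[of k] wrap[of k] asc[of k] corners[of k] assms by (simp add: disc_def)
  with \<open>hd (Ss k) = [0]\<close> lab[of k] show ?thesis
    unfolding block_def by (intro disjI1 exI[of _ "Ss k"]) simp
qed

lemma list_prod_power:
  "set xs \<subseteq> carrier G \<Longrightarrow> list_prod G (concat (replicate k xs)) = list_prod G xs [^] k"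
proof (induction k)
  case (Suc k)
  then have "set (concat (replicate k xs)) \<subseteq> carrier G" by auto
  with Suc nat_pow_Suc2[of "list_prod G xs" k] show ?case by simp
qed simp

text \<open>The power enters as one block of surplus \<open>k - 1\<close>, every further conjugate
  of \<open>h\<close> as a block of surplus 0.\<close>

lemma cactus_of_product:
  assumes gen: "\<And>g. g \<in> carrier G \<Longrightarrow> \<exists>gs. set gs \<subseteq> H True \<union> H False \<and> g = list_prod G gs"
    and h: "h = list_prod G (map c [0..<n])"
    and "0 < k" "g \<in> carrier G"
    and "\<forall>y \<in> set ys. \<exists>g \<in> carrier G. y = g \<otimes> h \<otimes> inv g"
  shows "\<exists>ws. cactus ws (k - 1) \<and> list_prod G ws = g \<otimes> h [^] k \<otimes> inv g \<otimes> list_prod G ys"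
  using assms(5)
proof (induction ys rule: rev_induct)
  have car: "set (map c [0..<n]) \<subseteq> carrier G" by (auto simp: c_carrier)
  have block: "block True b (j - 1) \<and> list_prod G b = h [^] j"
    if "0 < j" "b = concat (replicate j (map c [0..<n]))" for b j
    using that block_power list_prod_power[OF car] h by blast
  {
    case Nil
    obtain gs where gs: "set gs \<subseteq> H True \<union> H False" "g = list_prod G gs" using gen assms(4) by blast
    from cactus_mult_conjugate[OF cactus_one _ gs(1)] block[OF \<open>0 < k\<close> refl]
    have "\<exists>ws. cactus ws (0 + (k - 1)) \<and> list_prod G ws =
        list_prod G [\<one>] \<otimes> (list_prod G gs \<otimes> h [^] k \<otimes> inv (list_prod G gs))" by metis
    then show ?case using assms(4) gs h car by simp
  next
    case (snoc y ys)
    then obtain ws where ws: "cactus ws (k - 1)"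
      "list_prod G ws = g \<otimes> h [^] k \<otimes> inv g \<otimes> list_prod G ys" by auto
    from snoc.prems obtain u where u: "u \<in> carrier G" "y = u \<otimes> h \<otimes> inv u" by auto
    obtain gs where gs: "set gs \<subseteq> H True \<union> H False" "u = list_prod G gs" using gen u by blast
    have hc: "h \<in> carrier G" using h car by simp
    from cactus_mult_conjugate[OF ws(1) _ gs(1)] block[of 1, OF _ refl]
    have "\<exists>ws'. cactus ws' (k - 1 + (1 - 1)) \<and> list_prod G ws' =
        list_prod G ws \<otimes> (list_prod G gs \<otimes> h [^] (1::nat) \<otimes> inv (list_prod G gs))"
      by (metis zero_less_one)
    then obtain ws' where ws': "cactus ws' (k - 1)" "list_prod G ws' = list_prod G ws \<otimes> y"
      using u gs hc by auto
    have "set ys \<subseteq> carrier G" using snoc.prems hc by auto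
    then have "list_prod G ws' = g \<otimes> h [^] k \<otimes> inv g \<otimes> list_prod G (ys @ [y])"
      using ws' ws u hc assms(4) by (simp add: m_assoc)
    with ws'(1) show ?case by blast
  }
qed

end

section \<open>Application to free products of torsion free groups\<close>

locale torsion_free_product =
  fixes A :: "('a, 'm) monoid_scheme" and B :: "('b, 'n) monoid_scheme"
  assumes A: "torsion_free_group A" and B: "torsion_free_group B"
begin

sublocale A: group A using A by (simp add: torsion_free_group_def)
sublocale B: group B using B by (simp add: torsion_free_group_def)

abbreviation F where "F \<equiv> free_product A B"

definition factor :: "bool \<Rightarrow> ('a + 'b) list set" where
  "factor t = (if t then free_product_inl A ` carrier A else free_product_inr B ` carrier B)"

sublocale group F
  by (intro group_free_product A.is_group B.is_group)

sublocale inl: group_hom A F "free_product_inl A"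
  using free_product_inl_mon[OF A.is_group B.is_group]
  by (intro group_hom.intro group_hom_axioms.intro A.is_group B.is_group group_free_product)
    (simp add: mon_def)

sublocale inr: group_hom B F "free_product_inr B"
  using free_product_inr_mon[OF A.is_group B.is_group]
  by (intro group_hom.intro group_hom_axioms.intro A.is_group B.is_group group_free_product)
    (simp add: mon_def)

sublocale two_subgroups F factor
  by (intro two_subgroups.intro two_subgroups_axioms.intro A.is_group B.is_group group_free_product)
    (simp add: factor_def inl.img_is_subgroup inr.img_is_subgroup)

lemma carrier_F: "carrier F = reduced_words A B"
  and one_F: "\<one>\<^bsub>F\<^esub> = []"
  and mult_F: "u \<otimes>\<^bsub>F\<^esub> w = foldr (prepend_letter A B) u w"
  by (simp_all add: free_product_def)

lemma factor_cases:
  assumes "x \<in> factor t"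
  obtains "x = []" | l where "x = [l]" "isl l = t" "[l] \<in> reduced_words A B"
  using assms
  by (cases t) (auto simp: factor_def free_product_inl_def free_product_inr_def reduced_words_Cons InlI InrI
      split: if_splits)

lemma letter_in_factor: "[l] \<in> reduced_words A B \<Longrightarrow> [l] \<in> factor (isl l)"
  by (cases l) (auto simp: factor_def free_product_inl_def free_product_inr_def reduced_words_Cons image_iff)

lemma list_prod_letters: "w \<in> reduced_words A B \<Longrightarrow> list_prod F (map (\<lambda>l. [l]) w) = w"
  by (induction w)
    (auto simp: reduced_words_Cons one_F mult_F prepend_letter_reduced[OF A.is_group B.is_group])

lemma factors_generate:
  assumes "g \<in> carrier F"
  shows "\<exists>gs. set gs \<subseteq> factor True \<union> factor False \<and> g = list_prod F gs"
proof (intro exI conjI)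
  show "g = list_prod F (map (\<lambda>l. [l]) g)" using assms list_prod_letters by (simp add: carrier_F)
  have "\<forall>l \<in> set g. [l] \<in> reduced_words A B"
    using assms by (auto simp: carrier_F reduced_words_def)
  then show "set (map (\<lambda>l. [l]) g) \<subseteq> factor True \<union> factor False"
    using letter_in_factor by (auto, metis (full_types))
qed

definition right_letters :: "('a + 'b) list \<Rightarrow> nat" where
  "right_letters w = length (filter (\<lambda>l. \<not> isl l) w)"

text \<open>Neighbouring nonempty entries are single letters from different factors, so their
  concatenation is already reduced. An empty entry at either end brings no two letters of the same
  factor together.\<close>

lemma list_prod_reduced:
  assumes "alternating t ws" "[] \<notin> set (butlast (tl ws))"
  shows "list_prod F ws = concat ws"
  using assms
proof (induction ws arbitrary: t)
  case (Cons w ws)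
  have ne: "[] \<notin> set (butlast ws)" using Cons.prems by simp
  then have "[] \<notin> set (butlast (tl ws))" by (cases ws) (auto split: if_splits)
  then have IH: "list_prod F ws = concat ws" using Cons by auto
  have red: "concat ws \<in> reduced_words A B"
    using alternating_carrier[of "\<not> t" ws] Cons.prems list_prod_closed[of ws] IH by (simp add: carrier_F)
  have "w \<in> factor t" using Cons.prems by simp
  then show ?case
  proof (cases rule: factor_cases)
    case 2
    have "concat ws = [] \<or> isl (hd (concat ws)) \<noteq> t"
    proof (cases ws)
      case (Cons x xs)
      then have "x \<in> factor (\<not> t)" using Cons.prems by simp
      then show ?thesis
      proof (cases rule: factor_cases)
        case 1
        then show ?thesis using ne Cons by (auto split: if_splits)
      qed (use Cons in auto)
    qed simp
    with 2 red have "w @ concat ws \<in> reduced_words A B" by (auto simp: reduced_words_Cons)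
    then show ?thesis using 2 IH by (simp add: mult_F prepend_letter_reduced[OF A.is_group B.is_group])
  qed (use IH in \<open>simp add: mult_F\<close>)
qed (simp add: one_F)

text \<open>Every second entry lies in \<open>factor False\<close>. The rounding allows for an empty
  last entry.\<close>

lemma right_letters_concat:
  assumes "alternating t ws" "[] \<notin> set (butlast ws)"
  shows "(if t then length ws - 1 else length ws) div 2 \<le> right_letters (concat ws)"
  using assms
proof (induction ws arbitrary: t)
  case (Cons w ws)
  have IH: "(if \<not> t then length ws - 1 else length ws) div 2 \<le> right_letters (concat ws)"
    using Cons by (cases ws) auto
  have w: "ws \<noteq> [] \<longrightarrow> w \<noteq> []" "w \<in> factor t" using Cons.prems by auto
  from w(2) show ?case
  proof (cases rule: factor_cases)
    case 1
    then show ?thesis using w(1) by (auto simp: right_letters_def)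
  next
    case 2
    then show ?thesis using IH by (cases ws) (auto simp: right_letters_def split: if_splits)
  qed
qed simp

lemma length_prepend_letter: "length (prepend_letter A B l w) \<le> Suc (length w)"
  by (cases l; cases w) (auto split: sum.splits)

lemma length_foldr_prepend_letter: "length (foldr (prepend_letter A B) u w) \<le> length u + length w"
proof (induction u)
  case (Cons l u)
  then show ?case using length_prepend_letter[of l "foldr (prepend_letter A B) u w"] by simp
qed simp

lemma letter_pow:
  assumes "[l] \<in> reduced_words A B" "0 < r"
  shows "[l] [^]\<^bsub>F\<^esub> (r::nat) \<noteq> []"
proof (cases l)
  case (Inl a)
  then have a: "a \<in> carrier A" "a \<noteq> \<one>\<^bsub>A\<^esub>" "[l] = free_product_inl A a"
    using assms(1) by (auto simp: reduced_words_Cons free_product_inl_def)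
  then have "[l] [^]\<^bsub>F\<^esub> r = free_product_inl A (a [^]\<^bsub>A\<^esub> r)" by (simp add: inl.hom_nat_pow)
  moreover have "a [^]\<^bsub>A\<^esub> r \<noteq> \<one>\<^bsub>A\<^esub>" using A a assms(2) by (auto simp: torsion_free_group_def)
  ultimately show ?thesis by (simp add: free_product_inl_def)
next
  case (Inr b)
  then have b: "b \<in> carrier B" "b \<noteq> \<one>\<^bsub>B\<^esub>" "[l] = free_product_inr B b"
    using assms(1) by (auto simp: reduced_words_Cons free_product_inr_def)
  then have "[l] [^]\<^bsub>F\<^esub> r = free_product_inr B (b [^]\<^bsub>B\<^esub> r)" by (simp add: inr.hom_nat_pow)
  moreover have "b [^]\<^bsub>B\<^esub> r \<noteq> \<one>\<^bsub>B\<^esub>" using B b assms(2) by (auto simp: torsion_free_group_def)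
  ultimately show ?thesis by (simp add: free_product_inr_def)
qed

lemma reduced_word_alternates:
  "w \<in> reduced_words A B \<Longrightarrow> s < length w \<Longrightarrow> isl (w ! s) = (isl (hd w) = even s)"
proof (induction w arbitrary: s)
  case (Cons l w)
  show ?case
  proof (cases s)
    case (Suc s')
    then have "w \<noteq> []" using Cons.prems by auto
    then show ?thesis using Cons.IH[of s'] Cons.prems Suc by (auto simp: reduced_words_Cons)
  qed simp
qed simp

lemma cyclically_reduced_word:
  assumes w: "w \<in> reduced_words A B" "w \<noteq> []" "isl (hd w)" "\<not> isl (last w)"
  shows "cyclic_word F factor (length w) (\<lambda>s. [w ! s])"
    and "list_prod F (map (\<lambda>s. [w ! s]) [0..<length w]) = w"
proof -
  have letter: "[w ! s] \<in> reduced_words A B" if "s < length w" for s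
    using w(1) nth_mem[OF that] by (auto simp: reduced_words_def)
  show "cyclic_word F factor (length w) (\<lambda>s. [w ! s])"
  proof
    show "0 < length w" using w by simp
    show "even (length w)"
      using reduced_word_alternates[OF w(1), of "length w - 1"] w by (simp add: last_conv_nth)
    show "[w ! s] \<in> factor (even s)" if "s < length w" for s
      using letter_in_factor[OF letter[OF that]] reduced_word_alternates[OF w(1) that] w(3) by simp
    show "[w ! s] [^]\<^bsub>F\<^esub> (r::nat) \<noteq> \<one>\<^bsub>F\<^esub>" if "s < length w" "0 < r" for s r
      using letter_pow[OF letter] that by (simp add: one_F)
  qed
  have "map (\<lambda>s. [w ! s]) [0..<length w] = map (\<lambda>l. [l]) w"
    by (rule nth_equalityI) simp_all
  then show "list_prod F (map (\<lambda>s. [w ! s]) [0..<length w]) = w"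
    using list_prod_letters w(1) by simp
qed

text \<open>The first letter is moved to the end. If it belongs to the same factor as the last one,
  the two merge and the word gets shorter; otherwise a word that starts in \<open>B\<close> now
  starts in \<open>A\<close>. Words of at most one letter are excluded by the hypothesis.\<close>

lemma conjugate_cyclically_reduced:
  assumes "x \<in> reduced_words A B" "\<forall>y \<in> factor True \<union> factor False. \<not> conjugate_in F x y"
  shows "\<exists>w \<in> reduced_words A B. w \<noteq> [] \<and> isl (hd w) \<and> \<not> isl (last w) \<and> conjugate_in F x w"
  using assms
proof (induction "length x" arbitrary: x rule: less_induct)
  case less
  have refl: "conjugate_in F x x" using conjugate_in_refl less.prems(1) by (simp add: carrier_F)
  then have "x \<notin> factor True \<union> factor False" using less.prems(2) by blast
  then have "x \<noteq> []" "\<forall>l. x \<noteq> [l]"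
    using H_closed(3)[of True] letter_in_factor less.prems(1) by (auto simp: one_F, metis (full_types))
  then obtain l u k where x: "x = l # u @ [k]"
    by (metis append_butlast_last_id list.exhaust_sel)
  have l: "[l] \<in> reduced_words A B" and v: "u @ [k] \<in> reduced_words A B"
    and lk: "isl l \<noteq> isl (hd (u @ [k]))"
    using less.prems(1) x by (auto simp: reduced_words_Cons)
  define y where "y = (u @ [k]) \<otimes>\<^bsub>F\<^esub> [l]"
  have lc: "[l] \<in> carrier F" "u @ [k] \<in> carrier F" using l v by (simp_all add: carrier_F)
  have xc: "x \<in> carrier F" using less.prems(1) by (simp add: carrier_F)
  have yc: "y \<in> carrier F" unfolding y_def using lc by (intro m_closed)
  then have y: "y \<in> reduced_words A B" by (simp add: carrier_F)
  have "x = [l] \<otimes>\<^bsub>F\<^esub> (u @ [k])"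
    using prepend_letter_reduced[OF A.is_group B.is_group] less.prems(1) x by (simp add: mult_F)
  then have "y = inv\<^bsub>F\<^esub> [l] \<otimes>\<^bsub>F\<^esub> x \<otimes>\<^bsub>F\<^esub> inv\<^bsub>F\<^esub> (inv\<^bsub>F\<^esub> [l])"
    unfolding y_def using lc by (simp add: mult_inv_cancel)
  then have xy: "conjugate_in F x y"
    unfolding conjugate_in_def using inv_closed[OF lc(1)] by blast
  show ?case
  proof (cases "isl l = isl k")
    case True
    have "length (prepend_letter A B k [l]) \<le> 1" using True by (cases l; cases k) auto
    then have "length y < length x"
      using length_foldr_prepend_letter[of u "prepend_letter A B k [l]"] x by (simp add: y_def mult_F)
    moreover have "\<forall>z \<in> factor True \<union> factor False. \<not> conjugate_in F y z"
      using less.prems(2) conjugate_in_trans[OF xy _ xc] by blast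
    ultimately obtain w where "w \<in> reduced_words A B" "w \<noteq> []" "isl (hd w)" "\<not> isl (last w)" "conjugate_in F y w"
      using less.hyps[OF _ y] by blast
    then show ?thesis using conjugate_in_trans[OF xy _ xc] by blast
  next
    case False
    show ?thesis
    proof (cases "isl l")
      case True
      then show ?thesis using refl less.prems(1) x False by (intro bexI[of _ x]) auto
    next
      case nl: False
      have app: "foldr (prepend_letter A B) p [l] = p @ [l]"
        if "p \<in> reduced_words A B" "p = [] \<or> isl (last p)" for p
        using that
      proof (induction p)
        case (Cons q p)
        then have "q # p @ [l] \<in> reduced_words A B"
          using l nl by (auto simp: reduced_words_def successively_append_iff successively_Cons split: if_splits)
        then show ?case
          using Cons prepend_letter_reduced[OF A.is_group B.is_group, of q "p @ [l]"]
          by (auto simp: reduced_words_Cons split: if_splits)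
      qed simp
      have "y = (u @ [k]) @ [l]" using app[OF v] nl False by (simp add: y_def mult_F)
      then show ?thesis using xy y lk nl by (intro bexI[of _ y]) (auto simp: hd_append)
    qed
  qed
qed

text \<open>An element occurring \<open>k\<close> times yields a cactus of surplus
  \<open>k - 1\<close>, hence a reduced boundary word of length at least \<open>2 * k + 1\<close>.
  About half of its entries are letters from \<open>B\<close>, which gives at least \<open>k\<close>
  of them.\<close>

lemma count_le_right_letters:
  assumes hs: "set hs \<subseteq> carrier F" "\<forall>x \<in> set hs. \<forall>y \<in> set hs. conjugate_in F x y"
    and nconj: "\<forall>x \<in> set hs. \<forall>y \<in> factor True \<union> factor False. \<not> conjugate_in F x y"
    and x: "x \<in> set hs" and ne: "list_prod F hs \<noteq> []"
  shows "count_list hs x \<le> right_letters (list_prod F hs)"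
proof -
  have xc: "x \<in> carrier F" using x hs(1) by blast
  obtain w where w: "w \<in> reduced_words A B" "w \<noteq> []" "isl (hd w)" "\<not> isl (last w)" "conjugate_in F x w"
    using conjugate_cyclically_reduced[of x] xc x nconj by (auto simp: carrier_F)
  interpret cyclic_word F factor "length w" "\<lambda>s. [w ! s]"
    by (rule cyclically_reduced_word(1)) fact+
  have wconj: "\<exists>g \<in> carrier F. y = g \<otimes>\<^bsub>F\<^esub> w \<otimes>\<^bsub>F\<^esub> inv\<^bsub>F\<^esub> g" if "y \<in> set hs" for y
  proof -
    have "conjugate_in F w x" using conjugate_in_sym[OF w(5) xc] .
    moreover have "conjugate_in F x y" using hs(2) x that by blast
    ultimately have "conjugate_in F w y" using conjugate_in_trans[of w x y] w(1) by (simp add: carrier_F)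
    then show ?thesis by (simp only: conjugate_in_def)
  qed
  obtain ys where ys: "\<forall>y \<in> set ys. \<exists>h \<in> set hs. \<exists>g \<in> carrier F. y = g \<otimes>\<^bsub>F\<^esub> h \<otimes>\<^bsub>F\<^esub> inv\<^bsub>F\<^esub> g"
    and prod: "list_prod F hs = x [^]\<^bsub>F\<^esub> count_list hs x \<otimes>\<^bsub>F\<^esub> list_prod F ys"
    using list_prod_count[OF hs(1)] by blast
  have yconj: "\<forall>y \<in> set ys. \<exists>g \<in> carrier F. y = g \<otimes>\<^bsub>F\<^esub> w \<otimes>\<^bsub>F\<^esub> inv\<^bsub>F\<^esub> g"
  proof
    fix y assume "y \<in> set ys"
    then obtain h where h: "h \<in> set hs" "conjugate_in F h y"
      using ys unfolding conjugate_in_def by blast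
    moreover have "conjugate_in F w h" using wconj[OF h(1)] by (simp only: conjugate_in_def)
    ultimately have "conjugate_in F w y" using conjugate_in_trans[of w h y] w(1) by (simp add: carrier_F)
    then show "\<exists>g \<in> carrier F. y = g \<otimes>\<^bsub>F\<^esub> w \<otimes>\<^bsub>F\<^esub> inv\<^bsub>F\<^esub> g" by (simp only: conjugate_in_def)
  qed
  obtain g where g: "g \<in> carrier F" "x = g \<otimes>\<^bsub>F\<^esub> w \<otimes>\<^bsub>F\<^esub> inv\<^bsub>F\<^esub> g" using wconj[OF x] by blast
  have pow: "x [^]\<^bsub>F\<^esub> j = g \<otimes>\<^bsub>F\<^esub> w [^]\<^bsub>F\<^esub> j \<otimes>\<^bsub>F\<^esub> inv\<^bsub>F\<^esub> g" for j :: nat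
    using conjugate_pow[OF g(1)] g(2) w(1) by (simp add: carrier_F)
  have pos: "0 < count_list hs x" using x count_list_0_iff[of hs x] by (cases "count_list hs x") simp_all
  have "\<exists>ws. cactus ws (count_list hs x - 1) \<and> list_prod F ws =
      g \<otimes>\<^bsub>F\<^esub> w [^]\<^bsub>F\<^esub> count_list hs x \<otimes>\<^bsub>F\<^esub> inv\<^bsub>F\<^esub> g \<otimes>\<^bsub>F\<^esub> list_prod F ys"
    by (rule cactus_of_product[OF factors_generate _ pos g(1) yconj])
      (use cyclically_reduced_word(2)[OF w(1-4)] in simp_all)
  then obtain ws0 where "cactus ws0 (count_list hs x - 1)" "list_prod F ws0 = list_prod F hs"
    using prod pow by metis
  then obtain ws where ws: "cactus ws (count_list hs x - 1)" "list_prod F ws = list_prod F hs"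
    "\<one>\<^bsub>F\<^esub> \<notin> set (butlast (tl ws))"
    using cactus_reduced by metis
  have al: "alternating True ws" by (rule cactus_alternating) fact
  \<comment> \<open>The alternative \<open>[\<one>]\<close> in \<open>cactus_size\<close> would make
    the product trivial.\<close>
  have size: "2 * (count_list hs x - 1) + 3 \<le> length ws"
    using cactus_size[OF ws(1)] ws(2) ne by (auto simp: one_F mult_F)
  \<comment> \<open>The possibly empty first entry is split off. The rest starts in
    \<open>factor False\<close> and has at least twice as many entries as \<open>x\<close> has
    occurrences.\<close>
  obtain v vs where v: "ws = v # vs" using size by (cases ws) auto
  have "list_prod F ws = v @ concat vs"
    using list_prod_reduced[OF al] ws(3) v by (simp add: one_F)
  moreover have "length vs div 2 \<le> right_letters (concat vs)"
    using right_letters_concat[of False vs] al ws(3) v by (simp add: one_F)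
  ultimately have "length vs div 2 \<le> right_letters (list_prod F hs)"
    using ws(2) by (simp add: right_letters_def)
  then show ?thesis using size v pos by simp
qed

text \<open>The retraction of the free product onto \<open>A\<close> that kills \<open>B\<close>
  sends every factor to \<one> and fixes \<open>a\<close>. This serves the case of factors conjugate
  into \<open>B\<close>, which \<open>count_le_right_letters\<close> does not cover.\<close>

lemma inr_conjugate_product:
  assumes "set hs \<subseteq> carrier F" "\<forall>x \<in> set hs. \<exists>b \<in> carrier B. conjugate_in F x (free_product_inr B b)"
    and "a \<in> carrier A" "list_prod F hs = free_product_inl A a"
  shows "a = \<one>\<^bsub>A\<^esub>"
proof -
  have "(\<lambda>a. a) \<in> hom A A" "(\<lambda>b. \<one>\<^bsub>A\<^esub>) \<in> hom B A" by (auto simp: hom_def)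
  from free_product_universal(1)[OF A.is_group B.is_group A.is_group this]
  obtain r where r: "r \<in> hom F A" "\<And>a. a \<in> carrier A \<Longrightarrow> r (free_product_inl A a) = a"
    "\<And>b. b \<in> carrier B \<Longrightarrow> r (free_product_inr B b) = \<one>\<^bsub>A\<^esub>" by blast
  interpret r: group_hom F A r
    using r(1) by (intro group_hom.intro group_hom_axioms.intro A.is_group B.is_group group_free_product)
  have "r x = \<one>\<^bsub>A\<^esub>" if x: "x \<in> set hs" for x
  proof -
    have xc: "x \<in> carrier F" using assms(1) x by blast
    obtain b where b: "b \<in> carrier B" "conjugate_in F x (free_product_inr B b)" using assms(2) x by blast
    have "conjugate_in F (free_product_inr B b) x" by (rule conjugate_in_sym[OF b(2) xc])
    then obtain g where g: "g \<in> carrier F" "x = g \<otimes>\<^bsub>F\<^esub> free_product_inr B b \<otimes>\<^bsub>F\<^esub> inv\<^bsub>F\<^esub> g"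
      unfolding conjugate_in_def by blast
    then show ?thesis using b(1) r(3) by simp
  qed
  then have "r (list_prod F hs) = \<one>\<^bsub>A\<^esub>"
    using assms(1)
  proof (induction hs)
    case (Cons x hs)
    then have "x \<in> carrier F" "list_prod F hs \<in> carrier F" by (auto intro: list_prod_closed)
    then show ?case using Cons by simp
  qed simp
  then show ?thesis using assms(3,4) r(2) by simp
qed

text \<open>Factors conjugate into \<open>B\<close> are handled by the retraction. Otherwise the
  number of occurrences of \<open>x\<close> is bounded by the number of letters from
  \<open>B\<close> in \<open>[Inl a]\<close>, which is 0.\<close>

lemma inl_not_product:
  assumes "a \<in> carrier A - {\<one>\<^bsub>A\<^esub>}" "set hs \<subseteq> carrier F"
    and conj: "\<forall>x \<in> set hs. \<forall>y \<in> set hs. conjugate_in F x y"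
    and nconj: "\<forall>x \<in> set hs. \<forall>y \<in> free_product_inl A ` carrier A. \<not> conjugate_in F x y"
  shows "list_prod F hs \<noteq> free_product_inl A a"
proof
  assume eq: "list_prod F hs = free_product_inl A a"
  then have w: "list_prod F hs = [Inl a]" using assms(1) by (simp add: free_product_inl_def)
  then obtain x where x: "x \<in> set hs" by (cases hs) (auto simp: one_F)
  show False
  proof (cases "\<exists>b \<in> carrier B. conjugate_in F x (free_product_inr B b)")
    case True
    then obtain b where b: "b \<in> carrier B" "conjugate_in F x (free_product_inr B b)" by blast
    have "conjugate_in F y (free_product_inr B b)" if "y \<in> set hs" for y
      using conjugate_in_trans[OF _ b(2)] conj x that assms(2) by blast
    then have "a = \<one>\<^bsub>A\<^esub>"
      using inr_conjugate_product[of hs a] assms(1,2) eq b(1) by blast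
    then show False using assms(1) by simp
  next
    case False
    have "\<not> conjugate_in F y z" if "y \<in> set hs" "z \<in> factor True \<union> factor False" for y z
    proof
      assume yz: "conjugate_in F y z"
      then have "z \<in> free_product_inr B ` carrier B" using nconj that by (auto simp: factor_def)
      moreover have "conjugate_in F x z"
        using conjugate_in_trans[OF _ yz] conj x that(1) assms(2) by blast
      ultimately show False using False by blast
    qed
    then have "count_list hs x \<le> right_letters (list_prod F hs)"
      using count_le_right_letters[OF assms(2) conj _ x] w by auto
    then show False using w x count_list_0_iff[of hs x] by (simp add: right_letters_def)
  qed
qed

lemma right_letters_product:
  assumes "length as = length bs" "set as \<subseteq> carrier A - {\<one>\<^bsub>A\<^esub>}" "set bs \<subseteq> carrier B - {\<one>\<^bsub>B\<^esub>}"
  shows "right_letters (list_prod F (map2 (\<lambda>a b. free_product_inl A a \<otimes>\<^bsub>F\<^esub> free_product_inr B b) as bs)) = length as"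
proof -
  let ?p = "\<lambda>as bs. list_prod F (map2 (\<lambda>a b. free_product_inl A a \<otimes>\<^bsub>F\<^esub> free_product_inr B b) as bs)"
  have "right_letters (?p as bs) = length as \<and> ?p as bs \<in> reduced_words A B \<and>
      (?p as bs = [] \<or> isl (hd (?p as bs)))"
    using assms
  proof (induction as bs rule: list_induct2)
    case (Cons a as b bs)
    let ?w = "?p as bs"
    have ab: "a \<in> carrier A" "a \<noteq> \<one>\<^bsub>A\<^esub>" "b \<in> carrier B" "b \<noteq> \<one>\<^bsub>B\<^esub>" using Cons.prems by auto
    have IH: "right_letters ?w = length as" "?w \<in> reduced_words A B" "?w = [] \<or> isl (hd ?w)"
      using Cons by auto
    then have red: "Inl a # Inr b # ?w \<in> reduced_words A B" "Inr b # ?w \<in> reduced_words A B"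
      using ab by (auto simp: reduced_words_Cons)
    have "free_product_inl A a \<otimes>\<^bsub>F\<^esub> free_product_inr B b = [Inl a, Inr b]"
      using ab by (simp add: mult_F free_product_inl_def free_product_inr_def)
    then have "?p (a # as) (b # bs) = Inl a # Inr b # ?w"
      using prepend_letter_reduced[OF A.is_group B.is_group red(1)]
        prepend_letter_reduced[OF A.is_group B.is_group red(2)]
      by (simp add: mult_F)
    then show ?case using IH red by (simp add: right_letters_def)
  qed (simp add: one_F right_letters_def)
  then show ?thesis by blast
qed

end

theorem corollary4:
  fixes A :: "('a, 'm) monoid_scheme" and B :: "('b, 'n) monoid_scheme"
  defines "F \<equiv> free_product A B"
    and "\<iota>A \<equiv> (free_product_inl A :: 'a \<Rightarrow> ('a + 'b) list)"
    and "\<iota>B \<equiv> (free_product_inr B :: 'b \<Rightarrow> ('a + 'b) list)"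
  assumes "torsion_free_group A" and "torsion_free_group B"
  shows
    "(\<forall>a \<in> carrier A - {\<one>\<^bsub>A\<^esub>}.
        \<not> (\<exists>hs. set hs \<subseteq> carrier F \<and>
                (\<forall>x \<in> set hs. \<forall>y \<in> set hs. conjugate_in F x y) \<and>
                (\<forall>x \<in> set hs. \<forall>y \<in> \<iota>A ` carrier A. \<not> conjugate_in F x y) \<and>
                list_prod F hs = \<iota>A a))
     \<and>
     (\<forall>(as :: 'a list) (bs :: 'b list) (hs :: ('a + 'b) list list).
        length as = length bs \<and>
        set as \<subseteq> carrier A - {\<one>\<^bsub>A\<^esub>} \<and>
        set bs \<subseteq> carrier B - {\<one>\<^bsub>B\<^esub>} \<and>
        set hs \<subseteq> carrier F \<and>
        (\<forall>x \<in> set hs. \<forall>y \<in> set hs. conjugate_in F x y) \<and>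
        (\<forall>x \<in> set hs. \<forall>y \<in> \<iota>A ` carrier A \<union> \<iota>B ` carrier B. \<not> conjugate_in F x y) \<and>
        list_prod F (map2 (\<lambda>a b. \<iota>A a \<otimes>\<^bsub>F\<^esub> \<iota>B b) as bs) = list_prod F hs \<and>
        list_prod F hs \<noteq> \<one>\<^bsub>F\<^esub>
        \<longrightarrow> (\<forall>x. count_list hs x \<le> 2 * length as - 1))"
proof -
  interpret P: torsion_free_product A B using assms(4,5) by unfold_locales
  show ?thesis
    unfolding F_def \<iota>A_def \<iota>B_def
  proof (intro conjI allI impI ballI notI; (elim exE conjE)?)
    fix a hs
    assume "a \<in> carrier A - {\<one>\<^bsub>A\<^esub>}" "set hs \<subseteq> carrier P.F"
      "\<forall>x \<in> set hs. \<forall>y \<in> set hs. conjugate_in P.F x y"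
      "\<forall>x \<in> set hs. \<forall>y \<in> free_product_inl A ` carrier A. \<not> conjugate_in P.F x y"
      "list_prod P.F hs = free_product_inl A a"
    then show False using P.inl_not_product by blast
  next
    fix as bs x and hs :: "('a + 'b) list list"
    assume ab: "length as = length bs" "set as \<subseteq> carrier A - {\<one>\<^bsub>A\<^esub>}" "set bs \<subseteq> carrier B - {\<one>\<^bsub>B\<^esub>}"
      and hs: "set hs \<subseteq> carrier P.F" "\<forall>x \<in> set hs. \<forall>y \<in> set hs. conjugate_in P.F x y"
      and nconj: "\<forall>x \<in> set hs. \<forall>y \<in> free_product_inl A ` carrier A \<union> free_product_inr B ` carrier B.
        \<not> conjugate_in P.F x y"
      and eq: "list_prod P.F (map2 (\<lambda>a b. free_product_inl A a \<otimes>\<^bsub>P.F\<^esub> free_product_inr B b) as bs) = list_prod P.F hs"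
      and ne: "list_prod P.F hs \<noteq> \<one>\<^bsub>P.F\<^esub>"
    show "count_list hs x \<le> 2 * length as - 1"
    proof (cases "x \<in> set hs")
      case True
      have "\<forall>x \<in> set hs. \<forall>y \<in> P.factor True \<union> P.factor False. \<not> conjugate_in P.F x y"
        using nconj by (simp add: P.factor_def)
      then have "count_list hs x \<le> P.right_letters (list_prod P.F hs)"
        using P.count_le_right_letters[OF hs _ True] ne by (simp add: P.one_F)
      also have "\<dots> = length as" using P.right_letters_product[OF ab] eq by simp
      \<comment> \<open>The bound obtained is \<open>length as\<close>. For
        \<open>length as = 0\<close> truncated subtraction makes the right-hand side 0 as
        well.\<close>
      finally show ?thesis by simp
    qed simp
  qed
qed

end
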